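(* Let $\Lambda_1$ be a $k$-graph and $\Lambda_2$ an $\ell$-graph ($k,\ell\ge1$), both row-finite and without sources. Identify $\mathbb{Z}^{k+\ell}=\mathbb{Z}^k\times\mathbb{Z}^\ell$ and write $\mathbf{q}=(\mathbf{q}',\mathbf{q}'')$ with $\mathbf{q}'\in\mathbb{Z}^k$, $\mathbf{q}''\in\mathbb{Z}^\ell$. Then: (i) the tensor product $T_{\Lambda_1}\otimes T_{\Lambda_2}$ is a $\mathbb{Z}^{k+\ell}$-monoid, where $${}^{\mathbf{q}}\bigl(v(\mathbf{m})\otimes w(\mathbf{n})\bigr)=v(\mathbf{m}+\mathbf{q}')\otimes w(\mathbf{n}+\mathbf{q}'')$$ for all $v\in\Lambda_1^0$, $w\in\Lambda_2^0$, $\mathbf{m}\in\mathbb{Z}^k$, $\mathbf{n}\in\mathbb{Z}^\ell$, $\mathbf{q}\in\mathbb{Z}^{k+\ell}$; (ii) $T_{\Lambda_1\times\Lambda_2}$ and $T_{\Lambda_1}\otimes T_{\Lambda_2}$ are isomorphic as $\mathbb{Z}^{k+\ell}$-monoids.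
   Context: $\mathbb{N}=\{0,1,2,\dots\}$; $\mathbf{e}_i$ is the $i$-th unit vector. A $k$-graph is a countable small category $\Lambda$ with a functor $d:\Lambda\to\mathbb{N}^k$ (degree) such that whenever $d(\lambda)=\mathbf{n}+\mathbf{m}$ with $\mathbf{n},\mathbf{m}\in\mathbb{N}^k$ there are unique $\alpha,\beta\in\Lambda$ with $d(\alpha)=\mathbf{n}$, $d(\beta)=\mathbf{m}$, $\lambda=\alpha\beta$. The codomain and domain of a morphism $\lambda$ are $r(\lambda)$ and $s(\lambda)$. $\Lambda^{\mathbf{n}}=d^{-1}(\mathbf{n})$; elements of $\Lambda^0$ are identified with objects (vertices). $v\Lambda^{\mathbf{n}}=\{\lambda\in\Lambda^{\mathbf{n}}:r(\lambda)=v\}$. $\Lambda$ is row-finite without sources if $0<|v\Lambda^{\mathbf{n}}|<\infty$ for all $v,\mathbf{n}$. A $\Gamma$-monoid is a commutative monoid with an action of the group $\Gamma$ by monoid automorphisms; isomorphisms of $\Gamma$-monoids are equivariant monoid isomorphisms. The talented monoid $T_\Lambda$ of a row-finite $k$-graph without sources is the commutative monoid generated by symbols $v(\mathbf{n})$ ($v\in\Lambda^0$, $\mathbf{n}\in\mathbb{Z}^k$) subject to $v(\mathbf{n})=\sum_{\alpha\in v\Lambda^{\mathbf{e}_i}}s(\alpha)(\mathbf{n}+\mathbf{e}_i)$ for all $v,\mathbf{n}$ and $1\le i\le k$; it is a $\mathbb{Z}^k$-monoid via ${}^{\mathbf{q}}v(\mathbf{n})=v(\mathbf{n}+\mathbf{q})$.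 The product $\Lambda_1\times\Lambda_2$ is the product category, made a $(k+\ell)$-graph by the degree functor $(\lambda_1,\lambda_2)\mapsto(d_1(\lambda_1),d_2(\lambda_2))\in\mathbb{N}^k\times\mathbb{N}^\ell=\mathbb{N}^{k+\ell}$. The tensor product of commutative monoids is the commutative monoid universal for bilinear maps (maps that are monoid homomorphisms in each variable). *)

theory Defs
  imports "HOL-Analysis.Analysis" "HOL-Algebra.Group_Action" "HOL-Algebra.FiniteProduct" "HOL-Library.Multiset"
begin

section \<open>Higher-rank graphs\<close>

text \<open>
  The rank \<open>k \<ge> 1\<close> is the cardinality of a finite index type \<open>'k\<close>, so that
  \<open>\<nat>\<^sup>k\<close> and \<open>\<int>\<^sup>k\<close> are the types \<open>nat ^ 'k\<close> and \<open>int ^ 'k\<close>, and \<open>axis i 1\<close> is the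
  \<open>i\<close>-th unit vector.  Rank \<open>k + l\<close> is given by the index type \<open>'k + 'l\<close>.
\<close>

record ('o, 'm, 'k::finite) graph_data =
  obj :: "'o set"
  mor :: "'m set"
  rng :: "'m \<Rightarrow> 'o"
  src :: "'m \<Rightarrow> 'o"
  ident :: "'o \<Rightarrow> 'm"
  comp :: "'m \<Rightarrow> 'm \<Rightarrow> 'm"
  deg :: "'m \<Rightarrow> nat ^ 'k"

text \<open>The composite \<open>comp \<Lambda> \<alpha> \<beta>\<close> is \<open>\<alpha>\<beta>\<close>; it is meaningful if \<open>s(\<alpha>) = r(\<beta>)\<close>.
  The vertex set \<open>\<Lambda>\<^sup>0\<close> is represented by \<open>obj \<Lambda>\<close>: by the factorisation property the morphisms of
  degree zero are exactly the identities.\<close>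

locale small_category =
  fixes \<Lambda> :: "('o, 'm, 'k::finite) graph_data"
  assumes rng_closed: "\<alpha> \<in> mor \<Lambda> \<Longrightarrow> rng \<Lambda> \<alpha> \<in> obj \<Lambda>"
    and src_closed: "\<alpha> \<in> mor \<Lambda> \<Longrightarrow> src \<Lambda> \<alpha> \<in> obj \<Lambda>"
    and ident_closed: "v \<in> obj \<Lambda> \<Longrightarrow> ident \<Lambda> v \<in> mor \<Lambda>"
    and rng_ident: "v \<in> obj \<Lambda> \<Longrightarrow> rng \<Lambda> (ident \<Lambda> v) = v"
    and src_ident: "v \<in> obj \<Lambda> \<Longrightarrow> src \<Lambda> (ident \<Lambda> v) = v"
    and comp_closed: "\<lbrakk>\<alpha> \<in> mor \<Lambda>; \<beta> \<in> mor \<Lambda>; src \<Lambda> \<alpha> = rng \<Lambda> \<beta>\<rbrakk> \<Longrightarrow> comp \<Lambda> \<alpha> \<beta> \<in> mor \<Lambda>"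
    and rng_comp: "\<lbrakk>\<alpha> \<in> mor \<Lambda>; \<beta> \<in> mor \<Lambda>; src \<Lambda> \<alpha> = rng \<Lambda> \<beta>\<rbrakk> \<Longrightarrow> rng \<Lambda> (comp \<Lambda> \<alpha> \<beta>) = rng \<Lambda> \<alpha>"
    and src_comp: "\<lbrakk>\<alpha> \<in> mor \<Lambda>; \<beta> \<in> mor \<Lambda>; src \<Lambda> \<alpha> = rng \<Lambda> \<beta>\<rbrakk> \<Longrightarrow> src \<Lambda> (comp \<Lambda> \<alpha> \<beta>) = src \<Lambda> \<beta>"
    and comp_assoc: "\<lbrakk>\<alpha> \<in> mor \<Lambda>; \<beta> \<in> mor \<Lambda>; \<gamma> \<in> mor \<Lambda>; src \<Lambda> \<alpha> = rng \<Lambda> \<beta>; src \<Lambda> \<beta> = rng \<Lambda> \<gamma>\<rbrakk>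
      \<Longrightarrow> comp \<Lambda> (comp \<Lambda> \<alpha> \<beta>) \<gamma> = comp \<Lambda> \<alpha> (comp \<Lambda> \<beta> \<gamma>)"
    and ident_left: "\<alpha> \<in> mor \<Lambda> \<Longrightarrow> comp \<Lambda> (ident \<Lambda> (rng \<Lambda> \<alpha>)) \<alpha> = \<alpha>"
    and ident_right: "\<alpha> \<in> mor \<Lambda> \<Longrightarrow> comp \<Lambda> \<alpha> (ident \<Lambda> (src \<Lambda> \<alpha>)) = \<alpha>"

locale higher_rank_graph = small_category \<Lambda>
  for \<Lambda> :: "('o, 'm, 'k::finite) graph_data" +
  assumes countable_mor: "countable (mor \<Lambda>)"
    and deg_ident: "v \<in> obj \<Lambda> \<Longrightarrow> deg \<Lambda> (ident \<Lambda> v) = 0"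
    and deg_comp: "\<lbrakk>\<alpha> \<in> mor \<Lambda>; \<beta> \<in> mor \<Lambda>; src \<Lambda> \<alpha> = rng \<Lambda> \<beta>\<rbrakk>
      \<Longrightarrow> deg \<Lambda> (comp \<Lambda> \<alpha> \<beta>) = deg \<Lambda> \<alpha> + deg \<Lambda> \<beta>"
    and factorisation: "\<lbrakk>\<gamma> \<in> mor \<Lambda>; deg \<Lambda> \<gamma> = n + m\<rbrakk>
      \<Longrightarrow> \<exists>!(\<alpha>, \<beta>). \<alpha> \<in> mor \<Lambda> \<and> \<beta> \<in> mor \<Lambda> \<and> src \<Lambda> \<alpha> = rng \<Lambda> \<beta> \<and>
            deg \<Lambda> \<alpha> = n \<and> deg \<Lambda> \<beta> = m \<and> \<gamma> = comp \<Lambda> \<alpha> \<beta>"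

text \<open>\<open>paths \<Lambda> v n\<close> is \<open>v\<Lambda>\<^sup>n\<close>.\<close>

definition paths :: "('o, 'm, 'k::finite) graph_data \<Rightarrow> 'o \<Rightarrow> nat ^ 'k \<Rightarrow> 'm set" where
  "paths \<Lambda> v n = {\<alpha> \<in> mor \<Lambda>. deg \<Lambda> \<alpha> = n \<and> rng \<Lambda> \<alpha> = v}"

definition row_finite_no_sources :: "('o, 'm, 'k::finite) graph_data \<Rightarrow> bool" where
  "row_finite_no_sources \<Lambda> \<longleftrightarrow> (\<forall>v \<in> obj \<Lambda>. \<forall>n. finite (paths \<Lambda> v n) \<and> paths \<Lambda> v n \<noteq> {})"

definition join_vec :: "'a ^ 'k::finite \<Rightarrow> 'a ^ 'l::finite \<Rightarrow> 'a ^ ('k + 'l)" where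
  "join_vec m n = (\<chi> c. case c of Inl i \<Rightarrow> m $ i | Inr j \<Rightarrow> n $ j)"

definition fst_vec :: "'a ^ ('k::finite + 'l::finite) \<Rightarrow> 'a ^ 'k" where
  "fst_vec q = (\<chi> i. q $ Inl i)"

definition snd_vec :: "'a ^ ('k::finite + 'l::finite) \<Rightarrow> 'a ^ 'l" where
  "snd_vec q = (\<chi> j. q $ Inr j)"

definition prod_graph ::
  "('o1, 'm1, 'k::finite) graph_data \<Rightarrow> ('o2, 'm2, 'l::finite) graph_data
    \<Rightarrow> ('o1 \<times> 'o2, 'm1 \<times> 'm2, 'k + 'l) graph_data" where
  "prod_graph \<Lambda>1 \<Lambda>2 =
    \<lparr> obj = obj \<Lambda>1 \<times> obj \<Lambda>2,
      mor = mor \<Lambda>1 \<times> mor \<Lambda>2,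
      rng = (\<lambda>(\<alpha>, \<beta>). (rng \<Lambda>1 \<alpha>, rng \<Lambda>2 \<beta>)),
      src = (\<lambda>(\<alpha>, \<beta>). (src \<Lambda>1 \<alpha>, src \<Lambda>2 \<beta>)),
      ident = (\<lambda>(v, w). (ident \<Lambda>1 v, ident \<Lambda>2 w)),
      comp = (\<lambda>(\<alpha>, \<beta>) (\<alpha>', \<beta>'). (comp \<Lambda>1 \<alpha> \<alpha>', comp \<Lambda>2 \<beta> \<beta>')),
      deg = (\<lambda>(\<alpha>, \<beta>). join_vec (deg \<Lambda>1 \<alpha>) (deg \<Lambda>2 \<beta>)) \<rparr>"


section \<open>Commutative monoids given by generators and relations\<close>

text \<open>
  Finite multisets over \<open>X\<close> form the free commutative monoid on \<open>X\<close>;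
  \<open>pres_cong X R\<close> is the least congruence on it containing \<open>R\<close>.  Commutative monoids are
  written multiplicatively, following the conventions of the locale \<open>comm_monoid\<close>.
\<close>

inductive pres_cong ::
  "'x set \<Rightarrow> ('x multiset \<times> 'x multiset) set \<Rightarrow> 'x multiset \<Rightarrow> 'x multiset \<Rightarrow> bool"
  for X R where
  base: "(a, b) \<in> R \<Longrightarrow> pres_cong X R a b"
| refl: "set_mset a \<subseteq> X \<Longrightarrow> pres_cong X R a a"
| sym: "pres_cong X R a b \<Longrightarrow> pres_cong X R b a"
| trans: "pres_cong X R a b \<Longrightarrow> pres_cong X R b c \<Longrightarrow> pres_cong X R a c"
| add: "pres_cong X R a b \<Longrightarrow> pres_cong X R c d \<Longrightarrow> pres_cong X R (a + c) (b + d)"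

definition pres_class ::
  "'x set \<Rightarrow> ('x multiset \<times> 'x multiset) set \<Rightarrow> 'x multiset \<Rightarrow> 'x multiset set" where
  "pres_class X R a = {b. pres_cong X R a b}"

definition presented_monoid ::
  "'x set \<Rightarrow> ('x multiset \<times> 'x multiset) set \<Rightarrow> 'x multiset set monoid" where
  "presented_monoid X R =
    \<lparr> carrier = pres_class X R ` {a. set_mset a \<subseteq> X},
      mult = (\<lambda>A B. \<Union>a\<in>A. \<Union>b\<in>B. pres_class X R (a + b)),
      one = pres_class X R {#} \<rparr>"


section \<open>Monoids with a group action\<close>

text \<open>A multiplicative bijection of monoids preserves the unit, so \<open>iso\<close> gives monoid isomorphisms.\<close>

locale gamma_monoid = comm_monoid M + group_action \<Gamma> "carrier M" \<phi>
  for \<Gamma> :: "('g, 'r) monoid_scheme" and M :: "('a, 's) monoid_scheme" and \<phi> :: "'g \<Rightarrow> 'a \<Rightarrow> 'a" +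
  assumes automorphism: "g \<in> carrier \<Gamma> \<Longrightarrow> \<phi> g \<in> iso M M"

definition gamma_isomorphic ::
  "('g, 'r) monoid_scheme \<Rightarrow> ('a, 's) monoid_scheme \<Rightarrow> ('g \<Rightarrow> 'a \<Rightarrow> 'a)
    \<Rightarrow> ('b, 't) monoid_scheme \<Rightarrow> ('g \<Rightarrow> 'b \<Rightarrow> 'b) \<Rightarrow> bool" where
  "gamma_isomorphic \<Gamma> M \<phi> N \<psi> \<longleftrightarrow>
    gamma_monoid \<Gamma> M \<phi> \<and> gamma_monoid \<Gamma> N \<psi> \<and>
    (\<exists>f \<in> iso M N. \<forall>g \<in> carrier \<Gamma>. \<forall>x \<in> carrier M. f (\<phi> g x) = \<psi> g (f x))"

definition int_vec_group :: "(int ^ 'k::finite) monoid" where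
  "int_vec_group = \<lparr> carrier = UNIV, mult = (+), one = 0 \<rparr>"


section \<open>The talented monoid\<close>

definition talented_gens :: "('o, 'm, 'k::finite) graph_data \<Rightarrow> ('o \<times> (int ^ 'k)) set" where
  "talented_gens \<Lambda> = obj \<Lambda> \<times> UNIV"

definition talented_rels ::
  "('o, 'm, 'k::finite) graph_data
    \<Rightarrow> (('o \<times> (int ^ 'k)) multiset \<times> ('o \<times> (int ^ 'k)) multiset) set" where
  "talented_rels \<Lambda> =
    {({#(v, n)#}, (\<Sum>\<alpha> \<in> paths \<Lambda> v (axis i 1). {#(src \<Lambda> \<alpha>, n + axis i 1)#})) | v n i. v \<in> obj \<Lambda>}"

definition talented_monoid ::
  "('o, 'm, 'k::finite) graph_data \<Rightarrow> ('o \<times> (int ^ 'k)) multiset set monoid" where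
  "talented_monoid \<Lambda> = presented_monoid (talented_gens \<Lambda>) (talented_rels \<Lambda>)"

text \<open>The generator \<open>v(n)\<close>:\<close>

definition talented_elem ::
  "('o, 'm, 'k::finite) graph_data \<Rightarrow> 'o \<Rightarrow> int ^ 'k \<Rightarrow> ('o \<times> (int ^ 'k)) multiset set" where
  "talented_elem \<Lambda> v n = pres_class (talented_gens \<Lambda>) (talented_rels \<Lambda>) {#(v, n)#}"

text \<open>
  Values outside the carrier are cut off because \<open>group_action\<close> requires extensional functions.
\<close>

definition talented_action ::
  "('o, 'm, 'k::finite) graph_data \<Rightarrow> int ^ 'k
    \<Rightarrow> ('o \<times> (int ^ 'k)) multiset set \<Rightarrow> ('o \<times> (int ^ 'k)) multiset set" where
  "talented_action \<Lambda> q =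
    (\<lambda>A \<in> carrier (talented_monoid \<Lambda>). \<Union>a\<in>A. pres_class (talented_gens \<Lambda>) (talented_rels \<Lambda>)
      (image_mset (\<lambda>(v, n). (v, n + q)) a))"


section \<open>The tensor product of commutative monoids\<close>

definition tensor_rels ::
  "('a, 'r) monoid_scheme \<Rightarrow> ('b, 's) monoid_scheme
    \<Rightarrow> (('a \<times> 'b) multiset \<times> ('a \<times> 'b) multiset) set" where
  "tensor_rels M N =
    {({#(x \<otimes>\<^bsub>M\<^esub> x', y)#}, {#(x, y)#} + {#(x', y)#}) | x x' y.
       x \<in> carrier M \<and> x' \<in> carrier M \<and> y \<in> carrier N} \<union>
    {({#(x, y \<otimes>\<^bsub>N\<^esub> y')#}, {#(x, y)#} + {#(x, y')#}) | x y y'.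
       x \<in> carrier M \<and> y \<in> carrier N \<and> y' \<in> carrier N} \<union>
    {({#(\<one>\<^bsub>M\<^esub>, y)#}, {#}) | y. y \<in> carrier N} \<union>
    {({#(x, \<one>\<^bsub>N\<^esub>)#}, {#}) | x. x \<in> carrier M}"

definition tensor_monoid ::
  "('a, 'r) monoid_scheme \<Rightarrow> ('b, 's) monoid_scheme \<Rightarrow> ('a \<times> 'b) multiset set monoid" where
  "tensor_monoid M N = presented_monoid (carrier M \<times> carrier N) (tensor_rels M N)"

definition tensor_elem ::
  "('a, 'r) monoid_scheme \<Rightarrow> ('b, 's) monoid_scheme \<Rightarrow> 'a \<Rightarrow> 'b \<Rightarrow> ('a \<times> 'b) multiset set" where
  "tensor_elem M N x y = pres_class (carrier M \<times> carrier N) (tensor_rels M N) {#(x, y)#}"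

definition monoid_hom ::
  "('a, 'r) monoid_scheme \<Rightarrow> ('b, 's) monoid_scheme \<Rightarrow> ('a \<Rightarrow> 'b) \<Rightarrow> bool" where
  "monoid_hom M N f \<longleftrightarrow> f \<in> hom M N \<and> f \<one>\<^bsub>M\<^esub> = \<one>\<^bsub>N\<^esub>"

definition bilinear_map ::
  "('a, 'r) monoid_scheme \<Rightarrow> ('b, 's) monoid_scheme \<Rightarrow> ('c, 't) monoid_scheme
    \<Rightarrow> ('a \<Rightarrow> 'b \<Rightarrow> 'c) \<Rightarrow> bool" where
  "bilinear_map M N P f \<longleftrightarrow>
    (\<forall>y \<in> carrier N. monoid_hom M P (\<lambda>x. f x y)) \<and> (\<forall>x \<in> carrier M. monoid_hom N P (f x))"


section \<open>Basic facts\<close>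

locale presentation =
  fixes X :: "'x set" and R
  assumes rels: "(a, b) \<in> R \<Longrightarrow> set_mset a \<subseteq> X \<and> set_mset b \<subseteq> X"
begin

lemma cong_dom: "pres_cong X R a b \<Longrightarrow> set_mset a \<subseteq> X \<and> set_mset b \<subseteq> X"
  by (induction rule: pres_cong.induct) (auto dest: rels)

lemma class_eq: "pres_cong X R a b \<Longrightarrow> pres_class X R a = pres_class X R b"
  unfolding pres_class_def by (blast intro: pres_cong.intros)

lemma class_self: "set_mset a \<subseteq> X \<Longrightarrow> a \<in> pres_class X R a"
  unfolding pres_class_def by (simp add: pres_cong.refl)

lemma class_closed: "set_mset a \<subseteq> X \<Longrightarrow> pres_class X R a \<in> carrier (presented_monoid X R)"
  by (auto simp: presented_monoid_def)

lemma carrierE: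
  assumes "A \<in> carrier (presented_monoid X R)"
  obtains a where "set_mset a \<subseteq> X" "A = pres_class X R a"
  using assms by (auto simp: presented_monoid_def)

lemma lift_eq:
  assumes "\<And>a b. pres_cong X R a b \<Longrightarrow> f a = f b" and "set_mset a \<subseteq> X"
  shows "(\<Union>b \<in> pres_class X R a. f b) = f a"
proof -
  have "f b = f a" if "b \<in> pres_class X R a" for b
    using that assms(1) by (auto simp: pres_class_def)
  then show ?thesis using class_self[OF assms(2)] by blast
qed

lemma mult_class:
  assumes "set_mset a \<subseteq> X" "set_mset b \<subseteq> X"
  shows "pres_class X R a \<otimes>\<^bsub>presented_monoid X R\<^esub> pres_class X R b = pres_class X R (a + b)"
proof -
  have "(\<Union>b' \<in> pres_class X R b. pres_class X R (a' + b')) = pres_class X R (a' + b)"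
    if "set_mset a' \<subseteq> X" for a'
    by (rule lift_eq[of "\<lambda>b'. pres_class X R (a' + b')"])
      (use that assms in \<open>auto intro!: class_eq pres_cong.add pres_cong.refl\<close>)
  then have "pres_class X R a \<otimes>\<^bsub>presented_monoid X R\<^esub> pres_class X R b
      = (\<Union>a' \<in> pres_class X R a. pres_class X R (a' + b))"
    using cong_dom by (auto simp: presented_monoid_def pres_class_def)
  also have "\<dots> = pres_class X R (a + b)"
    by (rule lift_eq[of "\<lambda>a'. pres_class X R (a' + b)"])
      (use assms in \<open>auto intro!: class_eq pres_cong.add pres_cong.refl\<close>)
  finally show ?thesis .
qed

lemma one_class: "\<one>\<^bsub>presented_monoid X R\<^esub> = pres_class X R {#}"
  by (simp add: presented_monoid_def)

lemma comm_monoid_presented: "comm_monoid (presented_monoid X R)"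
proof (rule comm_monoidI)
  fix A B assume "A \<in> carrier (presented_monoid X R)" "B \<in> carrier (presented_monoid X R)"
  then show "A \<otimes>\<^bsub>presented_monoid X R\<^esub> B \<in> carrier (presented_monoid X R)"
    by (elim carrierE) (simp add: mult_class class_closed)
next
  show "\<one>\<^bsub>presented_monoid X R\<^esub> \<in> carrier (presented_monoid X R)"
    by (simp add: one_class class_closed)
next
  fix A B C
  assume "A \<in> carrier (presented_monoid X R)" "B \<in> carrier (presented_monoid X R)"
    "C \<in> carrier (presented_monoid X R)"
  then show "A \<otimes>\<^bsub>presented_monoid X R\<^esub> B \<otimes>\<^bsub>presented_monoid X R\<^esub> C
      = A \<otimes>\<^bsub>presented_monoid X R\<^esub> (B \<otimes>\<^bsub>presented_monoid X R\<^esub> C)"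
    by (elim carrierE) (simp add: mult_class add.assoc)
next
  fix A assume "A \<in> carrier (presented_monoid X R)"
  then show "\<one>\<^bsub>presented_monoid X R\<^esub> \<otimes>\<^bsub>presented_monoid X R\<^esub> A = A"
    by (elim carrierE) (simp add: mult_class one_class)
next
  fix A B assume "A \<in> carrier (presented_monoid X R)" "B \<in> carrier (presented_monoid X R)"
  then show "A \<otimes>\<^bsub>presented_monoid X R\<^esub> B = B \<otimes>\<^bsub>presented_monoid X R\<^esub> A"
    by (elim carrierE) (simp add: mult_class add.commute)
qed

lemma presented_extend:
  assumes P: "comm_monoid P"
    and E0: "E {#} = \<one>\<^bsub>P\<^esub>"
    and E1: "\<And>x. x \<in> X \<Longrightarrow> E {#x#} \<in> carrier P"
    and Eadd: "\<And>a b. \<lbrakk>set_mset a \<subseteq> X; set_mset b \<subseteq> X\<rbrakk> \<Longrightarrow> E (a + b) = E a \<otimes>\<^bsub>P\<^esub> E b"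
    and ER: "\<And>a b. (a, b) \<in> R \<Longrightarrow> E a = E b"
  shows "\<exists>h. monoid_hom (presented_monoid X R) P h \<and>
    (\<forall>a. set_mset a \<subseteq> X \<longrightarrow> h (pres_class X R a) = E a)"
proof -
  interpret P: comm_monoid P by fact
  have Econg: "E a = E b" if "pres_cong X R a b" for a b
    using that
  proof (induction rule: pres_cong.induct)
    case (add a b c d)
    then show ?case using cong_dom[OF add(1)] cong_dom[OF add(2)] by (simp add: Eadd)
  qed (simp_all add: ER)
  have Ecl: "set_mset a \<subseteq> X \<Longrightarrow> E a \<in> carrier P" for a
  proof (induction a)
    case empty then show ?case by (simp add: E0)
  next
    case (add x a)
    then show ?case using Eadd[of "{#x#}" a] E1 by simp
  qed
  define h where "h A = E (SOME a. a \<in> A)" for A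
  have h: "h (pres_class X R a) = E a" if "set_mset a \<subseteq> X" for a
    using someI[of "\<lambda>b. b \<in> pres_class X R a", OF class_self[OF that]] Econg
    unfolding h_def by (auto simp: pres_class_def)
  have "monoid_hom (presented_monoid X R) P h"
    unfolding monoid_hom_def hom_def
    by (auto elim!: carrierE simp: mult_class h Ecl Eadd E0 one_class)
  then show ?thesis using h by blast
qed

lemma presented_hom_unique:
  assumes P: "comm_monoid P"
    and h: "monoid_hom (presented_monoid X R) P h" and h': "monoid_hom (presented_monoid X R) P h'"
    and eq: "\<And>x. x \<in> X \<Longrightarrow> h (pres_class X R {#x#}) = h' (pres_class X R {#x#})"
    and A: "A \<in> carrier (presented_monoid X R)"
  shows "h A = h' A"
proof -
  have "set_mset a \<subseteq> X \<Longrightarrow> h (pres_class X R a) = h' (pres_class X R a)" for a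
  proof (induction a)
    case empty
    then show ?case using h h' by (simp add: monoid_hom_def one_class)
  next
    case (add x a)
    then have *: "pres_class X R (add_mset x a) =
      pres_class X R {#x#} \<otimes>\<^bsub>presented_monoid X R\<^esub> pres_class X R a"
      by (simp add: mult_class)
    show ?case unfolding * using add h h' eq
      by (simp add: monoid_hom_def hom_def class_closed)
  qed
  then show ?thesis using A by (auto elim: carrierE)
qed

end

text \<open>\<open>tensor_monoid M N\<close> with \<open>tensor_elem M N\<close> is universal for bilinear maps.\<close>

lemma presentation_tensor:
  assumes "comm_monoid M" "comm_monoid N"
  shows "presentation (carrier M \<times> carrier N) (tensor_rels M N)"
proof -
  interpret M: comm_monoid M by fact
  interpret N: comm_monoid N by fact
  show ?thesis by unfold_locales (auto simp: tensor_rels_def)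
qed

lemma tensor_bilinear:
  assumes "comm_monoid M" "comm_monoid N"
  shows "comm_monoid (tensor_monoid M N)"
    and "bilinear_map M N (tensor_monoid M N) (tensor_elem M N)"
proof -
  interpret presentation "carrier M \<times> carrier N" "tensor_rels M N"
    using assms by (rule presentation_tensor)
  show "comm_monoid (tensor_monoid M N)"
    unfolding tensor_monoid_def by (rule comm_monoid_presented)
  have 1: "tensor_elem M N x y \<in> carrier (tensor_monoid M N)"
    if "x \<in> carrier M" "y \<in> carrier N" for x y
    unfolding tensor_elem_def tensor_monoid_def using that by (auto intro: class_closed)
  have 2: "tensor_elem M N (x \<otimes>\<^bsub>M\<^esub> x') y
      = tensor_elem M N x y \<otimes>\<^bsub>tensor_monoid M N\<^esub> tensor_elem M N x' y"
    if "x \<in> carrier M" "x' \<in> carrier M" "y \<in> carrier N" for x x' y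
  proof -
    have "({#(x \<otimes>\<^bsub>M\<^esub> x', y)#}, {#(x, y)#} + {#(x', y)#}) \<in> tensor_rels M N"
      unfolding tensor_rels_def using that by blast
    from class_eq[OF pres_cong.base[OF this]] show ?thesis
      using that mult_class[of "{#(x, y)#}" "{#(x', y)#}"]
      by (simp add: tensor_elem_def tensor_monoid_def)
  qed
  have 3: "tensor_elem M N x (y \<otimes>\<^bsub>N\<^esub> y')
      = tensor_elem M N x y \<otimes>\<^bsub>tensor_monoid M N\<^esub> tensor_elem M N x y'"
    if "x \<in> carrier M" "y \<in> carrier N" "y' \<in> carrier N" for x y y'
  proof -
    have "({#(x, y \<otimes>\<^bsub>N\<^esub> y')#}, {#(x, y)#} + {#(x, y')#}) \<in> tensor_rels M N"
      unfolding tensor_rels_def using that by blast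
    from class_eq[OF pres_cong.base[OF this]] show ?thesis
      using that mult_class[of "{#(x, y)#}" "{#(x, y')#}"]
      by (simp add: tensor_elem_def tensor_monoid_def)
  qed
  have 4: "tensor_elem M N \<one>\<^bsub>M\<^esub> y = \<one>\<^bsub>tensor_monoid M N\<^esub>" if "y \<in> carrier N" for y
    unfolding tensor_elem_def tensor_monoid_def one_class using that
    by (intro class_eq pres_cong.base) (simp add: tensor_rels_def)
  have 5: "tensor_elem M N x \<one>\<^bsub>N\<^esub> = \<one>\<^bsub>tensor_monoid M N\<^esub>" if "x \<in> carrier M" for x
    unfolding tensor_elem_def tensor_monoid_def one_class using that
    by (intro class_eq pres_cong.base) (simp add: tensor_rels_def)
  show "bilinear_map M N (tensor_monoid M N) (tensor_elem M N)"
    unfolding bilinear_map_def monoid_hom_def hom_def using 1 2 3 4 5 by auto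
qed

lemma tensor_universal:
  assumes M: "comm_monoid M" and N: "comm_monoid N" and P: "comm_monoid P"
    and f: "bilinear_map M N P f"
  shows "\<exists>h. monoid_hom (tensor_monoid M N) P h \<and>
    (\<forall>x \<in> carrier M. \<forall>y \<in> carrier N. h (tensor_elem M N x y) = f x y) \<and>
    (\<forall>h'. monoid_hom (tensor_monoid M N) P h' \<and>
        (\<forall>x \<in> carrier M. \<forall>y \<in> carrier N. h' (tensor_elem M N x y) = f x y) \<longrightarrow>
      (\<forall>t \<in> carrier (tensor_monoid M N). h' t = h t))"
proof -
  interpret M: comm_monoid M by fact
  interpret N: comm_monoid N by fact
  interpret P: comm_monoid P by fact
  interpret presentation "carrier M \<times> carrier N" "tensor_rels M N"
    using M N by (rule presentation_tensor)
  have f1: "f x y \<in> carrier P" if "x \<in> carrier M" "y \<in> carrier N" for x y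
    using f that by (auto simp: bilinear_map_def monoid_hom_def hom_def)
  define F where "F = (\<lambda>(x, y). f x y)"
  define E where "E a = finprod P (\<lambda>z. F z [^]\<^bsub>P\<^esub> count a z) (set_mset a)" for a
  have F: "F z \<in> carrier P" if "z \<in> carrier M \<times> carrier N" for z
    using that f1 by (auto simp: F_def)
  have E1: "E {#z#} = F z" if "z \<in> carrier M \<times> carrier N" for z
    using F[OF that] by (simp add: E_def)
  have Eadd: "E (a + b) = E a \<otimes>\<^bsub>P\<^esub> E b"
    if a: "set_mset a \<subseteq> carrier M \<times> carrier N" and b: "set_mset b \<subseteq> carrier M \<times> carrier N" for a b
  proof -
    let ?S = "set_mset a \<union> set_mset b"
    have S: "z \<in> ?S \<Longrightarrow> F z \<in> carrier P" for z using a b F by blast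
    have 1: "E a = finprod P (\<lambda>z. F z [^]\<^bsub>P\<^esub> count a z) ?S" unfolding E_def
      by (rule P.finprod_mono_neutral_cong_left) (use S in \<open>auto simp: not_in_iff\<close>)
    have 2: "E b = finprod P (\<lambda>z. F z [^]\<^bsub>P\<^esub> count b z) ?S" unfolding E_def
      by (rule P.finprod_mono_neutral_cong_left) (use S in \<open>auto simp: not_in_iff\<close>)
    have "E (a + b) = finprod P (\<lambda>z. F z [^]\<^bsub>P\<^esub> count a z \<otimes>\<^bsub>P\<^esub> F z [^]\<^bsub>P\<^esub> count b z) ?S"
      unfolding E_def set_mset_union
      by (rule P.finprod_cong') (use S in \<open>auto simp: P.nat_pow_mult\<close>)
    also have "\<dots> = E a \<otimes>\<^bsub>P\<^esub> E b" unfolding 1 2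
      by (rule P.finprod_multf) (use S in auto)
    finally show ?thesis .
  qed
  have ER: "E a = E b" if "(a, b) \<in> tensor_rels M N" for a b
  proof -
    have E0: "E {#} = \<one>\<^bsub>P\<^esub>" by (simp add: E_def)
    have E2: "E {#z, z'#} = F z \<otimes>\<^bsub>P\<^esub> F z'"
      if "z \<in> carrier M \<times> carrier N" "z' \<in> carrier M \<times> carrier N" for z z'
      using Eadd[of "{#z#}" "{#z'#}"] E1 that by (auto simp: add_mset_commute)
    show ?thesis using that f E0 unfolding tensor_rels_def
      by (elim UnE CollectE exE conjE)
        (auto simp: E1 E2 F_def f1 P.m_comm bilinear_map_def monoid_hom_def hom_def)
  qed
  obtain h where h: "monoid_hom (tensor_monoid M N) P h"
    and hE: "\<And>a. set_mset a \<subseteq> carrier M \<times> carrier N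
      \<Longrightarrow> h (pres_class (carrier M \<times> carrier N) (tensor_rels M N) a) = E a"
    using presented_extend[of P E] P E1 F Eadd ER unfolding tensor_monoid_def
    by (auto simp: E_def)
  have hf: "h (tensor_elem M N x y) = f x y" if "x \<in> carrier M" "y \<in> carrier N" for x y
    using that by (simp add: tensor_elem_def hE E1 F_def)
  show ?thesis
  proof (intro exI[of _ h] conjI ballI allI impI h)
    fix h' t
    assume h': "monoid_hom (tensor_monoid M N) P h' \<and>
        (\<forall>x \<in> carrier M. \<forall>y \<in> carrier N. h' (tensor_elem M N x y) = f x y)"
      and t: "t \<in> carrier (tensor_monoid M N)"
    show "h' t = h t"
      by (rule presented_hom_unique[OF P, of h' h])
        (use h' h hf t in \<open>auto simp: tensor_monoid_def tensor_elem_def\<close>)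
  qed (rule hf)
qed

lemma (in higher_rank_graph) presentation_talented:
  "presentation (talented_gens \<Lambda>) (talented_rels \<Lambda>)"
proof
  fix a b assume "(a, b) \<in> talented_rels \<Lambda>"
  then obtain v n i where *: "v \<in> obj \<Lambda>" "a = {#(v, n)#}"
      "b = (\<Sum>\<alpha> \<in> paths \<Lambda> v (axis i 1). {#(src \<Lambda> \<alpha>, n + axis i 1)#})"
    unfolding talented_rels_def by auto
  have "set_mset b \<subseteq> talented_gens \<Lambda>"
  proof (cases "finite (paths \<Lambda> v (axis i 1))")
    case True
    then show ?thesis unfolding *(3)
      by (auto simp: set_mset_sum talented_gens_def paths_def src_closed)
  qed (simp add: *(3))
  then show "set_mset a \<subseteq> talented_gens \<Lambda> \<and> set_mset b \<subseteq> talented_gens \<Lambda>"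
    using * by (auto simp: talented_gens_def)
qed

lemma (in higher_rank_graph) talented_action_elem:
  assumes v: "v \<in> obj \<Lambda>"
  shows "talented_action \<Lambda> q (talented_elem \<Lambda> v n) = talented_elem \<Lambda> v (n + q)"
proof -
  let ?X = "talented_gens \<Lambda>" and ?R = "talented_rels \<Lambda>"
  let ?s = "image_mset (\<lambda>(v :: 'a, n). (v, n + q))"
  interpret presentation ?X ?R by (rule presentation_talented)
  have s: "pres_cong ?X ?R (?s a) (?s b)" if "pres_cong ?X ?R a b" for a b
    using that
  proof (induction rule: pres_cong.induct)
    case (base a b)
    then obtain v n i where *: "v \<in> obj \<Lambda>" "a = {#(v, n)#}"
        "b = (\<Sum>\<alpha> \<in> paths \<Lambda> v (axis i 1). {#(src \<Lambda> \<alpha>, n + axis i 1)#})"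
      unfolding talented_rels_def by auto
    have "?s (\<Sum>\<alpha> \<in> S. {#(src \<Lambda> \<alpha>, n + axis i 1)#})
        = (\<Sum>\<alpha> \<in> S. {#(src \<Lambda> \<alpha>, (n + q) + axis i 1)#})" for S
      by (induction S rule: infinite_finite_induct) (auto simp: algebra_simps)
    then show ?case using * by (auto intro!: pres_cong.base simp: talented_rels_def)
  next
    case (refl a)
    then show ?case by (intro pres_cong.refl) (auto simp: talented_gens_def)
  qed (auto intro: pres_cong.sym pres_cong.trans pres_cong.add)
  have "talented_elem \<Lambda> v n \<in> carrier (talented_monoid \<Lambda>)"
    unfolding talented_elem_def talented_monoid_def
    by (rule class_closed) (simp add: v talented_gens_def)
  then have "talented_action \<Lambda> q (talented_elem \<Lambda> v n)
      = (\<Union>a \<in> pres_class ?X ?R {#(v, n)#}. pres_class ?X ?R (?s a))"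
    by (simp add: talented_action_def talented_elem_def)
  also have "\<dots> = pres_class ?X ?R (?s {#(v, n)#})"
    by (rule lift_eq[of "\<lambda>a. pres_class ?X ?R (?s a)", OF class_eq[OF s]])
      (simp_all add: v talented_gens_def)
  finally show ?thesis by (simp add: talented_elem_def)
qed

lemma join_vec_add: "join_vec (m + m') (n + n') = join_vec m n + join_vec m' n'"
  by (auto simp: join_vec_def vec_eq_iff split: sum.split)

lemma join_vec_zero: "join_vec 0 0 = 0"
  by (auto simp: join_vec_def vec_eq_iff split: sum.split)

lemma join_vec_eq_iff: "join_vec m n = q \<longleftrightarrow> m = fst_vec q \<and> n = snd_vec q"
  by (auto simp: join_vec_def fst_vec_def snd_vec_def vec_eq_iff split: sum.split)

lemma fst_vec_join: "fst_vec (join_vec m n) = m"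
  by (simp add: join_vec_def fst_vec_def vec_eq_iff)

lemma snd_vec_join: "snd_vec (join_vec m n) = n"
  by (simp add: join_vec_def snd_vec_def vec_eq_iff)

lemma fst_vec_add: "fst_vec (m + n) = fst_vec m + fst_vec n"
  by (simp add: fst_vec_def vec_eq_iff)

lemma snd_vec_add: "snd_vec (m + n) = snd_vec m + snd_vec n"
  by (simp add: snd_vec_def vec_eq_iff)

lemma paths_prod_graph:
  "paths (prod_graph \<Lambda>1 \<Lambda>2) (v, w) q = paths \<Lambda>1 v (fst_vec q) \<times> paths \<Lambda>2 w (snd_vec q)"
  by (auto simp: paths_def prod_graph_def join_vec_eq_iff fst_vec_join snd_vec_join)

lemma row_finite_prod_graph:
  "row_finite_no_sources \<Lambda>1 \<Longrightarrow> row_finite_no_sources \<Lambda>2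
    \<Longrightarrow> row_finite_no_sources (prod_graph \<Lambda>1 \<Lambda>2)"
  unfolding row_finite_no_sources_def
  by (auto simp: paths_prod_graph) (auto simp: prod_graph_def)

lemma ex1_pairE:
  assumes "\<exists>!(a, b). Q a b"
  obtains a b where "Q a b" and "\<And>a' b'. Q a' b' \<Longrightarrow> a' = a \<and> b' = b"
proof -
  from assms obtain p where p: "case_prod Q p" and u: "\<And>p'. case_prod Q p' \<Longrightarrow> p' = p"
    by (elim ex1E) blast
  obtain a b where ab: "p = (a, b)" by (cases p)
  show thesis
  proof (rule that)
    show "Q a b" using p by (simp add: ab)
    show "a' = a \<and> b' = b" if "Q a' b'" for a' b' using u[of "(a', b')"] that by (simp add: ab)
  qed
qed

lemma higher_rank_graph_prod:
  assumes "higher_rank_graph \<Lambda>1" "higher_rank_graph \<Lambda>2"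
  shows "higher_rank_graph (prod_graph \<Lambda>1 \<Lambda>2)"
proof -
  interpret A: higher_rank_graph \<Lambda>1 by fact
  interpret B: higher_rank_graph \<Lambda>2 by fact
  show ?thesis
  proof (unfold_locales, goal_cases)
    case (15 \<gamma> n m)
    obtain \<gamma>1 \<gamma>2 where \<gamma>: "\<gamma> = (\<gamma>1, \<gamma>2)" "\<gamma>1 \<in> mor \<Lambda>1" "\<gamma>2 \<in> mor \<Lambda>2"
      using 15 by (auto simp: prod_graph_def)
    have "deg \<Lambda>1 \<gamma>1 = fst_vec n + fst_vec m" "deg \<Lambda>2 \<gamma>2 = snd_vec n + snd_vec m"
      using 15 \<gamma> by (auto simp: prod_graph_def join_vec_eq_iff fst_vec_add snd_vec_add)
    note fac = A.factorisation[OF \<gamma>(2) this(1)] B.factorisation[OF \<gamma>(3) this(2)]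
    from fac(1) obtain \<alpha>1 \<beta>1 where 1: "\<alpha>1 \<in> mor \<Lambda>1 \<and> \<beta>1 \<in> mor \<Lambda>1 \<and> src \<Lambda>1 \<alpha>1 = rng \<Lambda>1 \<beta>1 \<and>
        deg \<Lambda>1 \<alpha>1 = fst_vec n \<and> deg \<Lambda>1 \<beta>1 = fst_vec m \<and> \<gamma>1 = comp \<Lambda>1 \<alpha>1 \<beta>1"
      and u1: "\<And>\<alpha> \<beta>. \<alpha> \<in> mor \<Lambda>1 \<and> \<beta> \<in> mor \<Lambda>1 \<and> src \<Lambda>1 \<alpha> = rng \<Lambda>1 \<beta> \<and>
        deg \<Lambda>1 \<alpha> = fst_vec n \<and> deg \<Lambda>1 \<beta> = fst_vec m \<and> \<gamma>1 = comp \<Lambda>1 \<alpha> \<beta> \<Longrightarrow> \<alpha> = \<alpha>1 \<and> \<beta> = \<beta>1"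
      by (rule ex1_pairE) (rule that; blast)
    from fac(2) obtain \<alpha>2 \<beta>2 where 2: "\<alpha>2 \<in> mor \<Lambda>2 \<and> \<beta>2 \<in> mor \<Lambda>2 \<and> src \<Lambda>2 \<alpha>2 = rng \<Lambda>2 \<beta>2 \<and>
        deg \<Lambda>2 \<alpha>2 = snd_vec n \<and> deg \<Lambda>2 \<beta>2 = snd_vec m \<and> \<gamma>2 = comp \<Lambda>2 \<alpha>2 \<beta>2"
      and u2: "\<And>\<alpha> \<beta>. \<alpha> \<in> mor \<Lambda>2 \<and> \<beta> \<in> mor \<Lambda>2 \<and> src \<Lambda>2 \<alpha> = rng \<Lambda>2 \<beta> \<and>
        deg \<Lambda>2 \<alpha> = snd_vec n \<and> deg \<Lambda>2 \<beta> = snd_vec m \<and> \<gamma>2 = comp \<Lambda>2 \<alpha> \<beta> \<Longrightarrow> \<alpha> = \<alpha>2 \<and> \<beta> = \<beta>2"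
      by (rule ex1_pairE) (rule that; blast)
    show ?case
    proof (rule ex1I[of _ "((\<alpha>1, \<alpha>2), (\<beta>1, \<beta>2))"])
      fix p assume p: "case p of (\<alpha>, \<beta>) \<Rightarrow>
        \<alpha> \<in> mor (prod_graph \<Lambda>1 \<Lambda>2) \<and> \<beta> \<in> mor (prod_graph \<Lambda>1 \<Lambda>2) \<and>
        src (prod_graph \<Lambda>1 \<Lambda>2) \<alpha> = rng (prod_graph \<Lambda>1 \<Lambda>2) \<beta> \<and>
        deg (prod_graph \<Lambda>1 \<Lambda>2) \<alpha> = n \<and> deg (prod_graph \<Lambda>1 \<Lambda>2) \<beta> = m \<and>
        \<gamma> = comp (prod_graph \<Lambda>1 \<Lambda>2) \<alpha> \<beta>"
      obtain a1 a2 b1 b2 where p_eq: "p = ((a1, a2), (b1, b2))" by (metis surj_pair)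
      have "a1 = \<alpha>1 \<and> b1 = \<beta>1"
        by (rule u1) (use p \<gamma>(1) in \<open>simp_all add: p_eq prod_graph_def join_vec_eq_iff\<close>)
      moreover have "a2 = \<alpha>2 \<and> b2 = \<beta>2"
        by (rule u2) (use p \<gamma>(1) in \<open>simp_all add: p_eq prod_graph_def join_vec_eq_iff\<close>)
      ultimately show "p = ((\<alpha>1, \<alpha>2), (\<beta>1, \<beta>2))" by (simp add: p_eq)
    qed (use 1 2 \<gamma>(1) in \<open>simp add: prod_graph_def join_vec_eq_iff\<close>)
  qed (auto simp: prod_graph_def A.rng_closed A.src_closed A.ident_closed A.rng_ident A.src_ident
      A.comp_closed A.rng_comp A.src_comp A.comp_assoc A.ident_left A.ident_right A.countable_mor
      A.deg_ident A.deg_comp B.rng_closed B.src_closed B.ident_closed B.rng_ident B.src_ident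
      B.comp_closed B.rng_comp B.src_comp B.comp_assoc B.ident_left B.ident_right B.countable_mor
      B.deg_ident B.deg_comp join_vec_add join_vec_zero)
qed

end

theory Submission
  imports Defs
begin

text \<open>
  Maps out of either monoid are determined by the generators \<open>(v, w)(m, n)\<close> and
  \<open>v(m) \<otimes> w(n)\<close>, so it suffices that both directions of \<open>(v, w)(m, n) \<leftrightarrow> v(m) \<otimes> w(n)\<close> are
  well defined. From left to right this holds because an edge of \<open>\<Lambda>1 \<times> \<Lambda>2\<close> is an edge of one
  factor paired with a vertex of the other. From right to left one extends the map to
  \<open>T \<Lambda>1\<close> for fixed \<open>w(n)\<close>, then to \<open>T \<Lambda>2\<close> for fixed \<open>x \<in> T \<Lambda>1\<close>. The action on the tensor
  product is the one transported along the resulting isomorphism.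
\<close>

section \<open>Monoid homomorphisms and finite products\<close>

lemma monoid_hom_closed: "monoid_hom M N f \<Longrightarrow> x \<in> carrier M \<Longrightarrow> f x \<in> carrier N"
  by (auto simp: monoid_hom_def hom_def)

lemma monoid_hom_mult:
  "monoid_hom M N f \<Longrightarrow> x \<in> carrier M \<Longrightarrow> y \<in> carrier M \<Longrightarrow> f (x \<otimes>\<^bsub>M\<^esub> y) = f x \<otimes>\<^bsub>N\<^esub> f y"
  by (auto simp: monoid_hom_def hom_def)

lemma monoid_hom_one: "monoid_hom M N f \<Longrightarrow> f \<one>\<^bsub>M\<^esub> = \<one>\<^bsub>N\<^esub>"
  by (auto simp: monoid_hom_def)

lemma monoid_homI:
  assumes "\<And>x. x \<in> carrier M \<Longrightarrow> f x \<in> carrier N"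
    and "\<And>x y. x \<in> carrier M \<Longrightarrow> y \<in> carrier M \<Longrightarrow> f (x \<otimes>\<^bsub>M\<^esub> y) = f x \<otimes>\<^bsub>N\<^esub> f y"
    and "f \<one>\<^bsub>M\<^esub> = \<one>\<^bsub>N\<^esub>"
  shows "monoid_hom M N f"
  using assms by (auto simp: monoid_hom_def hom_def)

lemma monoid_hom_id: "monoid_hom M M (\<lambda>x. x)"
  by (simp add: monoid_hom_def hom_def)

lemma monoid_hom_compose:
  "monoid_hom M N f \<Longrightarrow> monoid_hom N P g \<Longrightarrow> monoid_hom M P (\<lambda>x. g (f x))"
  by (auto simp: monoid_hom_def hom_def Pi_iff)

text \<open>Serves to carry the edge sum of a generator through tensoring with a fixed
  element.\<close>

lemma monoid_hom_finprod:
  assumes "comm_monoid M" "comm_monoid N" and f: "monoid_hom M N f"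
    and "finite S" "\<And>s. s \<in> S \<Longrightarrow> F s \<in> carrier M"
  shows "f (finprod M F S) = finprod N (\<lambda>s. f (F s)) S"
proof -
  interpret M: comm_monoid M by fact
  interpret N: comm_monoid N by fact
  from assms(4,5) show ?thesis
  proof (induction S)
    case empty
    then show ?case by (simp add: monoid_hom_one[OF f])
  next
    case (insert s S)
    have "(\<lambda>s. f (F s)) \<in> insert s S \<rightarrow> carrier N" "F \<in> insert s S \<rightarrow> carrier M"
      using insert.prems by (auto intro: monoid_hom_closed[OF f])
    then show ?case using insert
      by (subst M.finprod_insert N.finprod_insert; auto simp: monoid_hom_mult[OF f])+
  qed
qed

text \<open>Commutativity of \<open>P\<close> makes pointwise products of homomorphisms
  multiplicative. Edge sums of homomorphisms can therefore be compared with homomorphisms on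
  generators alone.\<close>

lemma finprod_monoid_hom:
  assumes "comm_monoid M" "comm_monoid P" and h: "\<And>s. s \<in> S \<Longrightarrow> monoid_hom M P (h s)"
  shows "monoid_hom M P (\<lambda>x. finprod P (\<lambda>s. h s x) S)"
proof -
  interpret M: comm_monoid M by fact
  interpret P: comm_monoid P by fact
  note hs = monoid_hom_closed[OF h] monoid_hom_mult[OF h] monoid_hom_one[OF h]
  show ?thesis
  proof (rule monoid_homI)
    fix x y assume xy: "x \<in> carrier M" "y \<in> carrier M"
    have "finprod P (\<lambda>s. h s (x \<otimes>\<^bsub>M\<^esub> y)) S = finprod P (\<lambda>s. h s x \<otimes>\<^bsub>P\<^esub> h s y) S"
      by (rule P.finprod_cong') (use xy hs in auto)
    also have "\<dots> = finprod P (\<lambda>s. h s x) S \<otimes>\<^bsub>P\<^esub> finprod P (\<lambda>s. h s y) S"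
      by (rule P.finprod_multf) (use xy hs in auto)
    finally show "finprod P (\<lambda>s. h s (x \<otimes>\<^bsub>M\<^esub> y)) S
      = finprod P (\<lambda>s. h s x) S \<otimes>\<^bsub>P\<^esub> finprod P (\<lambda>s. h s y) S" .
  qed (auto intro!: P.finprod_closed P.finprod_one_eqI simp: hs)
qed

lemma iso_if_inverse_homs:
  assumes f: "monoid_hom M N f" and g: "monoid_hom N M g"
    and "\<And>x. x \<in> carrier M \<Longrightarrow> g (f x) = x" "\<And>y. y \<in> carrier N \<Longrightarrow> f (g y) = y"
  shows "f \<in> iso M N"
  unfolding iso_def
  using f bij_betw_byWitness[of "carrier M" g f "carrier N"] assms(3,4)
    monoid_hom_closed[OF f] monoid_hom_closed[OF g]
  by (auto simp: monoid_hom_def)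

section \<open>Actions of a group on a commutative monoid and their transport\<close>

lemma gamma_monoidI:
  assumes "comm_monoid M" "group \<Gamma>"
    and ext: "\<And>g. g \<in> carrier \<Gamma> \<Longrightarrow> \<phi> g \<in> extensional (carrier M)"
    and hom: "\<And>g. g \<in> carrier \<Gamma> \<Longrightarrow> \<phi> g \<in> hom M M"
    and one: "\<And>x. x \<in> carrier M \<Longrightarrow> \<phi> \<one>\<^bsub>\<Gamma>\<^esub> x = x"
    and mult: "\<And>g h x. g \<in> carrier \<Gamma> \<Longrightarrow> h \<in> carrier \<Gamma> \<Longrightarrow> x \<in> carrier M
      \<Longrightarrow> \<phi> (g \<otimes>\<^bsub>\<Gamma>\<^esub> h) x = \<phi> g (\<phi> h x)"
  shows "gamma_monoid \<Gamma> M \<phi>"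
proof -
  interpret M: comm_monoid M by fact
  interpret G: group \<Gamma> by fact
  \<comment> \<open>The inverse group element acts as the inverse map, so an action by endomorphisms
    is automatically one by automorphisms.\<close>
  have bij: "bij_betw (\<phi> g) (carrier M) (carrier M)" if g: "g \<in> carrier \<Gamma>" for g
  proof (rule bij_betw_byWitness[of _ "\<phi> (inv\<^bsub>\<Gamma>\<^esub> g)"])
    show "\<forall>x\<in>carrier M. \<phi> (inv\<^bsub>\<Gamma>\<^esub> g) (\<phi> g x) = x" "\<forall>x\<in>carrier M. \<phi> g (\<phi> (inv\<^bsub>\<Gamma>\<^esub> g) x) = x"
      using g by (simp_all flip: mult add: one)
  qed (use g hom[of g] hom[of "inv\<^bsub>\<Gamma>\<^esub> g"] in \<open>auto simp: hom_def\<close>)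
  \<comment> \<open>The group law of \<open>BijGroup\<close> is \<open>compose\<close>, which is cut
    off outside the carrier. The pointwise law \<open>mult\<close> becomes an equality of functions
    through extensionality.\<close>
  have "\<phi> (g \<otimes>\<^bsub>\<Gamma>\<^esub> h) = compose (carrier M) (\<phi> g) (\<phi> h)"
    if "g \<in> carrier \<Gamma>" "h \<in> carrier \<Gamma>" for g h
    by (rule extensionalityI[of _ "carrier M"]) (use that ext mult in \<open>auto simp: compose_def\<close>)
  then have "group_hom \<Gamma> (BijGroup (carrier M)) \<phi>"
    using bij ext
    by (intro group_hom.intro group_hom_axioms.intro assms(2) group_BijGroup)
      (auto simp: hom_def BijGroup_def Bij_def)
  then interpret group_action \<Gamma> "carrier M" \<phi> by (simp add: group_action_def)
  show ?thesis
    by unfold_locales (use bij hom in \<open>auto simp: iso_def\<close>)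
qed

text \<open>Conjugating each \<open>\<phi> g\<close> by \<open>f\<close> makes \<open>f\<close>
  equivariant by construction. The action laws pass to \<open>N\<close> because the inverse of
  \<open>f\<close> cancels against \<open>f\<close> between consecutive factors.\<close>

lemma gamma_isomorphic_transport:
  assumes M: "gamma_monoid \<Gamma> M \<phi>" and N: "comm_monoid N" and f: "f \<in> iso M N"
  defines "\<psi> \<equiv> \<lambda>g. \<lambda>y \<in> carrier N. f (\<phi> g (inv_into (carrier M) f y))"
  shows "gamma_isomorphic \<Gamma> M \<phi> N \<psi>"
proof -
  interpret M: gamma_monoid \<Gamma> M \<phi> by fact
  let ?k = "inv_into (carrier M) f"
  have bij: "bij_betw f (carrier M) (carrier N)" and fh: "f \<in> hom M N"
    using f by (auto simp: iso_def)
  have kf: "x \<in> carrier M \<Longrightarrow> ?k (f x) = x" and fk: "y \<in> carrier N \<Longrightarrow> f (?k y) = y"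
    and kc: "y \<in> carrier N \<Longrightarrow> ?k y \<in> carrier M" and fc: "x \<in> carrier M \<Longrightarrow> f x \<in> carrier N" for x y
    using bij by (auto simp: bij_betw_def f_inv_into_f inv_into_into)
  have k: "?k (y \<otimes>\<^bsub>N\<^esub> y') = ?k y \<otimes>\<^bsub>M\<^esub> ?k y'" if "y \<in> carrier N" "y' \<in> carrier N" for y y'
    using that kf[of "?k y \<otimes>\<^bsub>M\<^esub> ?k y'"] hom_mult[OF fh, of "?k y" "?k y'"] by (simp add: kc fk)
  have \<phi>h: "\<phi> g \<in> hom M M" and \<phi>c: "x \<in> carrier M \<Longrightarrow> \<phi> g x \<in> carrier M"
    if "g \<in> carrier \<Gamma>" for g x
    using M.automorphism[OF that] by (auto simp: iso_def hom_def)
  have "gamma_monoid \<Gamma> N \<psi>"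
  proof (rule gamma_monoidI[OF N])
    show "group \<Gamma>" by (rule group_hom.axioms(1)[OF M.group_hom])
    show "\<psi> g \<in> hom N N" if "g \<in> carrier \<Gamma>" for g
      using that N
      by (auto intro!: homI simp: \<psi>_def kc fc \<phi>c k hom_mult[OF fh] hom_mult[OF \<phi>h]
          comm_monoid_def monoid.m_closed)
    show "\<psi> \<one>\<^bsub>\<Gamma>\<^esub> y = y" if "y \<in> carrier N" for y
      using that by (simp add: \<psi>_def M.id_eq_one[symmetric] kc fk)
    show "\<psi> (g \<otimes>\<^bsub>\<Gamma>\<^esub> h) y = \<psi> g (\<psi> h y)"
      if "g \<in> carrier \<Gamma>" "h \<in> carrier \<Gamma>" "y \<in> carrier N" for g h y
      using that by (simp add: \<psi>_def M.composition_rule kc fc \<phi>c kf)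
  qed (simp add: \<psi>_def)
  moreover have "f (\<phi> g x) = \<psi> g (f x)" if "x \<in> carrier M" for g x
    using that by (simp add: \<psi>_def fc kf)
  ultimately show ?thesis
    unfolding gamma_isomorphic_def using M f by blast
qed

lemma group_int_vec_group: "group int_vec_group"
proof (rule groupI)
  fix x :: "int ^ 'a" assume "x \<in> carrier int_vec_group"
  show "\<exists>y\<in>carrier int_vec_group. y \<otimes>\<^bsub>int_vec_group\<^esub> x = \<one>\<^bsub>int_vec_group\<^esub>"
    by (rule bexI[of _ "- x"]) (simp_all add: int_vec_group_def)
qed (simp_all add: int_vec_group_def add.assoc)

section \<open>Universal properties of presented monoids\<close>

text \<open>This is the homomorphic extension of \<open>g\<close> to the free commutative monoid. It
  is a product of powers over the support because \<open>finprod\<close> needs commutativity only on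
  the carrier.\<close>

definition mset_prod :: "('a, 'r) monoid_scheme \<Rightarrow> ('x \<Rightarrow> 'a) \<Rightarrow> 'x multiset \<Rightarrow> 'a" where
  "mset_prod P g a = finprod P (\<lambda>x. g x [^]\<^bsub>P\<^esub> count a x) (set_mset a)"

context comm_monoid
begin

lemma mset_prod_empty: "mset_prod G g {#} = \<one>"
  by (simp add: mset_prod_def)

lemma mset_prod_single: "g x \<in> carrier G \<Longrightarrow> mset_prod G g {#x#} = g x"
  by (simp add: mset_prod_def)

lemma mset_prod_union:
  assumes "\<And>x. x \<in> set_mset a \<union> set_mset b \<Longrightarrow> g x \<in> carrier G"
  shows "mset_prod G g (a + b) = mset_prod G g a \<otimes> mset_prod G g b"
proof -
  let ?S = "set_mset a \<union> set_mset b"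
  \<comment> \<open>Enlarging both supports to their union only adds zeroth powers, so the two
    products run over the same index set.\<close>
  have a: "mset_prod G g a = finprod G (\<lambda>x. g x [^] count a x) ?S" unfolding mset_prod_def
    by (rule finprod_mono_neutral_cong_left) (use assms in \<open>auto simp: not_in_iff\<close>)
  have b: "mset_prod G g b = finprod G (\<lambda>x. g x [^] count b x) ?S" unfolding mset_prod_def
    by (rule finprod_mono_neutral_cong_left) (use assms in \<open>auto simp: not_in_iff\<close>)
  have "mset_prod G g (a + b) = finprod G (\<lambda>x. g x [^] count a x \<otimes> g x [^] count b x) ?S"
    unfolding mset_prod_def set_mset_union
    by (rule finprod_cong') (use assms in \<open>auto simp: nat_pow_mult\<close>)
  also have "\<dots> = mset_prod G g a \<otimes> mset_prod G g b" unfolding a b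
    by (rule finprod_multf) (use assms in auto)
  finally show ?thesis .
qed

text \<open>Evaluates the right-hand side of a talented relation. Distinct paths may have the same
  source, so \<open>F\<close> may repeat values; induction on \<open>S\<close> accounts for the
  multiplicities.\<close>

lemma mset_prod_sum:
  assumes "finite S" "\<And>s. s \<in> S \<Longrightarrow> g (F s) \<in> carrier G"
  shows "mset_prod G g (\<Sum>s\<in>S. {#F s#}) = finprod G (\<lambda>s. g (F s)) S"
  using assms
proof (induction S)
  case (insert s S)
  have "mset_prod G g ({#F s#} + (\<Sum>s\<in>S. {#F s#}))
      = mset_prod G g {#F s#} \<otimes> mset_prod G g (\<Sum>s\<in>S. {#F s#})"
    by (rule mset_prod_union) (use insert in \<open>auto simp: set_mset_sum\<close>)
  then show ?case using insert
    by (simp add: mset_prod_single)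
qed (simp add: mset_prod_empty)

end

context presentation
begin

text \<open>With \<open>mset_prod P g\<close> as the extension, \<open>presented_extend\<close>
  becomes the universal property in terms of generators.\<close>

lemma presented_lift:
  assumes P: "comm_monoid P" and g: "\<And>x. x \<in> X \<Longrightarrow> g x \<in> carrier P"
    and R: "\<And>a b. (a, b) \<in> R \<Longrightarrow> mset_prod P g a = mset_prod P g b"
  shows "\<exists>h. monoid_hom (presented_monoid X R) P h \<and> (\<forall>x \<in> X. h (pres_class X R {#x#}) = g x)"
proof -
  interpret P: comm_monoid P by fact
  have "\<exists>h. monoid_hom (presented_monoid X R) P h \<and>
      (\<forall>a. set_mset a \<subseteq> X \<longrightarrow> h (pres_class X R a) = mset_prod P g a)"
    by (rule presented_extend[OF P])
      (use g R in \<open>auto simp: P.mset_prod_empty P.mset_prod_single intro!: P.mset_prod_union\<close>)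
  then show ?thesis using g by (auto simp: P.mset_prod_single)
qed

text \<open>Passing to classes is multiplicative, so a relation between multisets can be read as an
  equation inside the presented monoid.\<close>

lemma class_sum:
  assumes "finite S" "\<And>s. s \<in> S \<Longrightarrow> F s \<in> X"
  shows "pres_class X R (\<Sum>s\<in>S. {#F s#})
    = finprod (presented_monoid X R) (\<lambda>s. pres_class X R {#F s#}) S"
proof -
  interpret T: comm_monoid "presented_monoid X R" by (rule comm_monoid_presented)
  from assms show ?thesis
  proof (induction S)
    case (insert s S)
    then have "set_mset (\<Sum>s\<in>S. {#F s#}) \<subseteq> X" by (auto simp: set_mset_sum)
    then show ?case using insert mult_class[of "{#F s#}" "\<Sum>s\<in>S. {#F s#}"]
      by (subst T.finprod_insert) (auto intro: class_closed)
  qed (simp add: one_class)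
qed

end

section \<open>The talented monoid of a row-finite graph\<close>

locale row_finite_graph = higher_rank_graph +
  assumes row_finite: "row_finite_no_sources \<Lambda>"
begin

sublocale presentation "talented_gens \<Lambda>" "talented_rels \<Lambda>"
  by (rule presentation_talented)

lemma finite_paths: "v \<in> obj \<Lambda> \<Longrightarrow> finite (paths \<Lambda> v n)"
  using row_finite by (auto simp: row_finite_no_sources_def)

lemma src_paths: "\<alpha> \<in> paths \<Lambda> v n \<Longrightarrow> src \<Lambda> \<alpha> \<in> obj \<Lambda>"
  by (simp add: paths_def src_closed)

text \<open>Degree-zero morphisms are identities: compare \<open>\<alpha> = r(\<alpha>)\<alpha>\<close> with \<open>\<alpha> = \<alpha> s(\<alpha>)\<close>.\<close>

lemma paths_zero:
  assumes "v \<in> obj \<Lambda>"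
  shows "paths \<Lambda> v 0 = {ident \<Lambda> v}"
proof -
  have "\<alpha> = ident \<Lambda> (rng \<Lambda> \<alpha>)" if \<alpha>: "\<alpha> \<in> mor \<Lambda>" "deg \<Lambda> \<alpha> = 0" for \<alpha>
  proof -
    have "\<exists>!(\<beta>, \<gamma>). \<beta> \<in> mor \<Lambda> \<and> \<gamma> \<in> mor \<Lambda> \<and> src \<Lambda> \<beta> = rng \<Lambda> \<gamma> \<and>
        deg \<Lambda> \<beta> = 0 \<and> deg \<Lambda> \<gamma> = 0 \<and> \<alpha> = comp \<Lambda> \<beta> \<gamma>"
      by (rule factorisation) (use \<alpha> in auto)
    then obtain b c where u: "\<And>\<beta> \<gamma>. \<beta> \<in> mor \<Lambda> \<and> \<gamma> \<in> mor \<Lambda> \<and> src \<Lambda> \<beta> = rng \<Lambda> \<gamma> \<and>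
        deg \<Lambda> \<beta> = 0 \<and> deg \<Lambda> \<gamma> = 0 \<and> \<alpha> = comp \<Lambda> \<beta> \<gamma> \<Longrightarrow> \<beta> = b \<and> \<gamma> = c"
      by (rule ex1_pairE) (rule that; blast)
    have "ident \<Lambda> (rng \<Lambda> \<alpha>) = b \<and> \<alpha> = c"
      by (rule u) (use \<alpha> in \<open>simp add: ident_closed rng_closed src_ident ident_left deg_ident\<close>)
    moreover have "\<alpha> = b \<and> ident \<Lambda> (src \<Lambda> \<alpha>) = c"
      by (rule u) (use \<alpha> in \<open>simp add: ident_closed src_closed rng_ident ident_right deg_ident\<close>)
    ultimately show ?thesis by metis
  qed
  then show ?thesis
    using assms by (auto simp: paths_def ident_closed deg_ident rng_ident)
qed

lemma comm_monoid_talented: "comm_monoid (talented_monoid \<Lambda>)"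
  unfolding talented_monoid_def by (rule comm_monoid_presented)

lemma talented_elem_closed: "v \<in> obj \<Lambda> \<Longrightarrow> talented_elem \<Lambda> v n \<in> carrier (talented_monoid \<Lambda>)"
  unfolding talented_elem_def talented_monoid_def
  by (rule class_closed) (simp add: talented_gens_def)

lemma talented_elem_relation:
  assumes "v \<in> obj \<Lambda>"
  shows "talented_elem \<Lambda> v n = finprod (talented_monoid \<Lambda>)
    (\<lambda>\<alpha>. talented_elem \<Lambda> (src \<Lambda> \<alpha>) (n + axis i 1)) (paths \<Lambda> v (axis i 1))"
proof -
  have "talented_elem \<Lambda> v n = pres_class (talented_gens \<Lambda>) (talented_rels \<Lambda>)
      (\<Sum>\<alpha> \<in> paths \<Lambda> v (axis i 1). {#(src \<Lambda> \<alpha>, n + axis i 1)#})"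
    unfolding talented_elem_def
    by (intro class_eq pres_cong.base) (use assms in \<open>auto simp: talented_rels_def\<close>)
  also have "\<dots> = finprod (talented_monoid \<Lambda>)
      (\<lambda>\<alpha>. talented_elem \<Lambda> (src \<Lambda> \<alpha>) (n + axis i 1)) (paths \<Lambda> v (axis i 1))"
    unfolding talented_elem_def talented_monoid_def
    by (rule class_sum)
      (use assms in \<open>auto simp: finite_paths src_paths talented_gens_def\<close>)
  finally show ?thesis .
qed

text \<open>The path sets are finite, so \<open>mset_prod_sum\<close> turns compatibility with the
  presentation into the edge equation in \<open>P\<close>.\<close>

lemma talented_lift:
  assumes P: "comm_monoid P" and g: "\<And>v n. v \<in> obj \<Lambda> \<Longrightarrow> g v n \<in> carrier P"
    and R: "\<And>v n i. v \<in> obj \<Lambda>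
      \<Longrightarrow> g v n = finprod P (\<lambda>\<alpha>. g (src \<Lambda> \<alpha>) (n + axis i 1)) (paths \<Lambda> v (axis i 1))"
  shows "\<exists>h. monoid_hom (talented_monoid \<Lambda>) P h \<and>
    (\<forall>v \<in> obj \<Lambda>. \<forall>n. h (talented_elem \<Lambda> v n) = g v n)"
proof -
  interpret P: comm_monoid P by fact
  have "\<exists>h. monoid_hom (presented_monoid (talented_gens \<Lambda>) (talented_rels \<Lambda>)) P h \<and>
      (\<forall>x \<in> talented_gens \<Lambda>. h (pres_class (talented_gens \<Lambda>) (talented_rels \<Lambda>) {#x#})
        = case_prod g x)"
  proof (rule presented_lift[OF P])
    fix a b assume "(a, b) \<in> talented_rels \<Lambda>"
    then obtain v n i where *: "v \<in> obj \<Lambda>" "a = {#(v, n)#}"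
        "b = (\<Sum>\<alpha> \<in> paths \<Lambda> v (axis i 1). {#(src \<Lambda> \<alpha>, n + axis i 1)#})"
      unfolding talented_rels_def by auto
    have "mset_prod P (case_prod g) b
        = finprod P (\<lambda>\<alpha>. case_prod g (src \<Lambda> \<alpha>, n + axis i 1)) (paths \<Lambda> v (axis i 1))"
      unfolding *(3) by (rule P.mset_prod_sum) (use * in \<open>auto simp: finite_paths src_paths g\<close>)
    then show "mset_prod P (case_prod g) a = mset_prod P (case_prod g) b"
      using * R[of v n i] P.mset_prod_single[of "case_prod g" "(v, n)"] g[of v n] by simp
  qed (auto simp: talented_gens_def g)
  then show ?thesis
    by (auto simp: talented_monoid_def talented_elem_def talented_gens_def)
qed

lemma talented_hom_unique:
  assumes "comm_monoid P"
    and "monoid_hom (talented_monoid \<Lambda>) P h" "monoid_hom (talented_monoid \<Lambda>) P h'"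
    and "\<And>v n. v \<in> obj \<Lambda> \<Longrightarrow> h (talented_elem \<Lambda> v n) = h' (talented_elem \<Lambda> v n)"
    and "x \<in> carrier (talented_monoid \<Lambda>)"
  shows "h x = h' x"
  using assms presented_hom_unique[of P h h' x]
  by (auto simp: talented_monoid_def talented_elem_def talented_gens_def)

text \<open>Shifting all degrees by \<open>q\<close> sends defining relations to defining relations
  and hence induces an endomorphism \<open>h\<close>. The union in \<open>talented_action\<close> is
  then taken over a constant family and agrees with \<open>h\<close> on the carrier.\<close>

lemma talented_action_hom:
  "monoid_hom (talented_monoid \<Lambda>) (talented_monoid \<Lambda>) (talented_action \<Lambda> q)"
proof -
  let ?X = "talented_gens \<Lambda>" and ?R = "talented_rels \<Lambda>"
  let ?s = "image_mset (\<lambda>(v :: 'a, n). (v, n + q))"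
  have sX: "set_mset (?s a) \<subseteq> ?X" if "set_mset a \<subseteq> ?X" for a
    using that by (auto simp: talented_gens_def)
  have "\<exists>h. monoid_hom (presented_monoid ?X ?R) (talented_monoid \<Lambda>) h \<and>
      (\<forall>a. set_mset a \<subseteq> ?X \<longrightarrow> h (pres_class ?X ?R a) = pres_class ?X ?R (?s a))"
  proof (rule presented_extend[OF comm_monoid_talented])
    fix a b assume "(a, b) \<in> ?R"
    then obtain v n i where *: "v \<in> obj \<Lambda>" "a = {#(v, n)#}"
        "b = (\<Sum>\<alpha> \<in> paths \<Lambda> v (axis i 1). {#(src \<Lambda> \<alpha>, n + axis i 1)#})"
      unfolding talented_rels_def by auto
    \<comment> \<open>The shifted relation is the one for \<open>v\<close> at degree
      \<open>n + q\<close> in the same direction \<open>i\<close>.\<close>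
    have "?s (\<Sum>\<alpha> \<in> S. {#(src \<Lambda> \<alpha>, n + axis i 1)#})
        = (\<Sum>\<alpha> \<in> S. {#(src \<Lambda> \<alpha>, (n + q) + axis i 1)#})" for S
      by (induction S rule: infinite_finite_induct) (auto simp: algebra_simps)
    then have "(?s a, ?s b) \<in> ?R"
      using * by (auto simp: talented_rels_def)
    then show "pres_class ?X ?R (?s a) = pres_class ?X ?R (?s b)"
      by (intro class_eq pres_cong.base)
  next
    show "pres_class ?X ?R (?s {#}) = \<one>\<^bsub>talented_monoid \<Lambda>\<^esub>"
      by (simp add: talented_monoid_def one_class)
    show "pres_class ?X ?R (?s {#x#}) \<in> carrier (talented_monoid \<Lambda>)" if "x \<in> ?X" for x
      unfolding talented_monoid_def by (rule class_closed[OF sX]) (use that in simp)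
    show "pres_class ?X ?R (?s (a + b))
        = pres_class ?X ?R (?s a) \<otimes>\<^bsub>talented_monoid \<Lambda>\<^esub> pres_class ?X ?R (?s b)"
      if "set_mset a \<subseteq> ?X" "set_mset b \<subseteq> ?X" for a b
      unfolding talented_monoid_def mult_class[OF sX[OF that(1)] sX[OF that(2)]] by simp
  qed
  then obtain h where h: "monoid_hom (talented_monoid \<Lambda>) (talented_monoid \<Lambda>) h"
    and ha: "\<And>a. set_mset a \<subseteq> ?X \<Longrightarrow> h (pres_class ?X ?R a) = pres_class ?X ?R (?s a)"
    by (auto simp: talented_monoid_def)
  have "talented_action \<Lambda> q A = h A" if A: "A \<in> carrier (talented_monoid \<Lambda>)" for A
  proof -
    obtain a where a: "set_mset a \<subseteq> ?X" "A = pres_class ?X ?R a"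
      using A unfolding talented_monoid_def by (rule carrierE)
    \<comment> \<open>Congruent representatives have the same class, so \<open>h\<close> forces
      their shifted classes to coincide.\<close>
    have "(\<Union>b \<in> A. pres_class ?X ?R (?s b)) = pres_class ?X ?R (?s a)"
      unfolding a(2) by (rule lift_eq[OF _ a(1)]) (metis ha class_eq cong_dom)
    then show ?thesis using A a ha by (simp add: talented_action_def)
  qed
  then show ?thesis
    using h comm_monoid_talented
    by (auto simp: monoid_hom_def hom_def comm_monoid_def monoid.m_closed monoid.one_closed)
qed

text \<open>Each action law equates two homomorphisms, so it is enough to compare them at
  \<open>v(n)\<close>, where the laws are those of addition in the degree.\<close>

lemma gamma_monoid_talented:
  "gamma_monoid int_vec_group (talented_monoid \<Lambda>) (talented_action \<Lambda>)"
proof (rule gamma_monoidI[OF comm_monoid_talented group_int_vec_group])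
  fix x assume x: "x \<in> carrier (talented_monoid \<Lambda>)"
  show "talented_action \<Lambda> \<one>\<^bsub>int_vec_group\<^esub> x = x"
    by (rule talented_hom_unique[OF comm_monoid_talented talented_action_hom _ _ x])
      (auto simp: talented_action_elem int_vec_group_def monoid_hom_def hom_def)
  show "talented_action \<Lambda> (p \<otimes>\<^bsub>int_vec_group\<^esub> q) x = talented_action \<Lambda> p (talented_action \<Lambda> q x)"
    for p q
    by (rule talented_hom_unique[OF comm_monoid_talented talented_action_hom
          monoid_hom_compose[OF talented_action_hom talented_action_hom] _ x])
      (simp add: talented_action_elem int_vec_group_def ac_simps)
next
  show "talented_action \<Lambda> q \<in> hom (talented_monoid \<Lambda>) (talented_monoid \<Lambda>)" for q
    using talented_action_hom by (simp add: monoid_hom_def)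
qed (simp add: talented_action_def)

end

section \<open>Tensor generators and block decomposition of degrees\<close>

lemma tensor_hom_unique:
  assumes "comm_monoid M" "comm_monoid N" and P: "comm_monoid P"
    and h: "monoid_hom (tensor_monoid M N) P h" and h': "monoid_hom (tensor_monoid M N) P h'"
    and eq: "\<And>x y. x \<in> carrier M \<Longrightarrow> y \<in> carrier N
      \<Longrightarrow> h (tensor_elem M N x y) = h' (tensor_elem M N x y)"
    and t: "t \<in> carrier (tensor_monoid M N)"
  shows "h t = h' t"
proof -
  interpret presentation "carrier M \<times> carrier N" "tensor_rels M N"
    by (rule presentation_tensor) fact+
  show ?thesis
    by (rule presented_hom_unique[OF P, of h h'])
      (use h h' eq t in \<open>auto simp: tensor_monoid_def tensor_elem_def\<close>)
qed

lemma fst_vec_axis [simp]: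
  "fst_vec (axis (Inl i) c) = axis i c" "fst_vec (axis (Inr j) c) = 0"
  by (auto simp: fst_vec_def axis_def vec_eq_iff)

lemma snd_vec_axis [simp]:
  "snd_vec (axis (Inl i) c) = 0" "snd_vec (axis (Inr j) c) = axis j c"
  by (auto simp: snd_vec_def axis_def vec_eq_iff)

lemma join_vec_axis:
  "join_vec (m + axis i c) n = join_vec m n + axis (Inl i) c"
  "join_vec m (n + axis j c) = join_vec m n + axis (Inr j) c"
  for m :: "'a::monoid_add ^ 'k::finite" and n :: "'a ^ 'l::finite"
  by (auto simp: join_vec_eq_iff fst_vec_add snd_vec_add fst_vec_join snd_vec_join)

section \<open>Edges of the product graph\<close>

locale row_finite_graph_pair =
  A: row_finite_graph \<Lambda>1 + B: row_finite_graph \<Lambda>2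
  for \<Lambda>1 :: "('o1, 'm1, 'k::finite) graph_data" and \<Lambda>2 :: "('o2, 'm2, 'l::finite) graph_data"
begin

sublocale AB: row_finite_graph "prod_graph \<Lambda>1 \<Lambda>2"
  by (intro row_finite_graph.intro row_finite_graph_axioms.intro higher_rank_graph_prod
      row_finite_prod_graph A.higher_rank_graph_axioms B.higher_rank_graph_axioms
      A.row_finite B.row_finite)

abbreviation "T1 \<equiv> talented_monoid \<Lambda>1"
abbreviation "T2 \<equiv> talented_monoid \<Lambda>2"
abbreviation "TP \<equiv> talented_monoid (prod_graph \<Lambda>1 \<Lambda>2)"
abbreviation "TT \<equiv> tensor_monoid T1 T2"

lemma obj_prod: "obj (prod_graph \<Lambda>1 \<Lambda>2) = obj \<Lambda>1 \<times> obj \<Lambda>2"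
  by (simp add: prod_graph_def)

lemma src_prod: "src (prod_graph \<Lambda>1 \<Lambda>2) (\<alpha>, \<beta>) = (src \<Lambda>1 \<alpha>, src \<Lambda>2 \<beta>)"
  by (simp add: prod_graph_def)

text \<open>A unit vector of the joint degree vanishes on one of the two blocks, and the only path
  of degree zero at a vertex is its identity.\<close>

lemma paths_prod_axis:
  assumes "v \<in> obj \<Lambda>1" "w \<in> obj \<Lambda>2"
  shows "paths (prod_graph \<Lambda>1 \<Lambda>2) (v, w) (axis (Inl i) 1)
      = (\<lambda>\<alpha>. (\<alpha>, ident \<Lambda>2 w)) ` paths \<Lambda>1 v (axis i 1)"
    and "paths (prod_graph \<Lambda>1 \<Lambda>2) (v, w) (axis (Inr j) 1)
      = (\<lambda>\<beta>. (ident \<Lambda>1 v, \<beta>)) ` paths \<Lambda>2 w (axis j 1)"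
  using assms by (auto simp: paths_prod_graph A.paths_zero B.paths_zero)

text \<open>Pairing with an identity is injective and keeps the other vertex as source, so the
  product can be reindexed. The target \<open>P\<close> is arbitrary because the result is used both
  in \<open>TT\<close> and in \<open>TP\<close>.\<close>

lemma finprod_paths_prod:
  assumes "comm_monoid P" and v: "v \<in> obj \<Lambda>1" and w: "w \<in> obj \<Lambda>2"
    and g: "\<And>v w. v \<in> obj \<Lambda>1 \<Longrightarrow> w \<in> obj \<Lambda>2 \<Longrightarrow> g (v, w) \<in> carrier P"
  shows "finprod P (\<lambda>\<alpha>. g (src (prod_graph \<Lambda>1 \<Lambda>2) \<alpha>))
        (paths (prod_graph \<Lambda>1 \<Lambda>2) (v, w) (axis (Inl i) 1))
      = finprod P (\<lambda>\<alpha>. g (src \<Lambda>1 \<alpha>, w)) (paths \<Lambda>1 v (axis i 1))"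
    and "finprod P (\<lambda>\<alpha>. g (src (prod_graph \<Lambda>1 \<Lambda>2) \<alpha>))
        (paths (prod_graph \<Lambda>1 \<Lambda>2) (v, w) (axis (Inr j) 1))
      = finprod P (\<lambda>\<beta>. g (v, src \<Lambda>2 \<beta>)) (paths \<Lambda>2 w (axis j 1))"
proof -
  interpret P: comm_monoid P by fact
  show "finprod P (\<lambda>\<alpha>. g (src (prod_graph \<Lambda>1 \<Lambda>2) \<alpha>))
        (paths (prod_graph \<Lambda>1 \<Lambda>2) (v, w) (axis (Inl i) 1))
      = finprod P (\<lambda>\<alpha>. g (src \<Lambda>1 \<alpha>, w)) (paths \<Lambda>1 v (axis i 1))"
    unfolding paths_prod_axis(1)[OF v w]
    by (subst P.finprod_reindex)
      (auto simp: src_prod w A.src_paths B.src_ident g inj_on_def intro!: P.finprod_cong')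
  show "finprod P (\<lambda>\<alpha>. g (src (prod_graph \<Lambda>1 \<Lambda>2) \<alpha>))
        (paths (prod_graph \<Lambda>1 \<Lambda>2) (v, w) (axis (Inr j) 1))
      = finprod P (\<lambda>\<beta>. g (v, src \<Lambda>2 \<beta>)) (paths \<Lambda>2 w (axis j 1))"
    unfolding paths_prod_axis(2)[OF v w]
    by (subst P.finprod_reindex)
      (auto simp: src_prod v B.src_paths A.src_ident g inj_on_def intro!: P.finprod_cong')
qed

section \<open>Homomorphisms between \<open>TP\<close> and \<open>TT\<close>\<close>

abbreviation "prod_elem v w m n \<equiv> talented_elem (prod_graph \<Lambda>1 \<Lambda>2) (v, w) (join_vec m n)"
abbreviation "pure_elem v w m n \<equiv>
  tensor_elem T1 T2 (talented_elem \<Lambda>1 v m) (talented_elem \<Lambda>2 w n)"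

lemmas comm_monoids =
  A.comm_monoid_talented B.comm_monoid_talented AB.comm_monoid_talented
  tensor_bilinear(1)[OF A.comm_monoid_talented B.comm_monoid_talented]

lemma tensor_elem_hom:
  "y \<in> carrier T2 \<Longrightarrow> monoid_hom T1 TT (\<lambda>x. tensor_elem T1 T2 x y)"
  "x \<in> carrier T1 \<Longrightarrow> monoid_hom T2 TT (tensor_elem T1 T2 x)"
  using tensor_bilinear(2)[OF A.comm_monoid_talented B.comm_monoid_talented]
  by (auto simp: bilinear_map_def)

lemma prod_elem_closed: "v \<in> obj \<Lambda>1 \<Longrightarrow> w \<in> obj \<Lambda>2 \<Longrightarrow> prod_elem v w m n \<in> carrier TP"
  by (simp add: AB.talented_elem_closed obj_prod)

lemma pure_elem_closed: "v \<in> obj \<Lambda>1 \<Longrightarrow> w \<in> obj \<Lambda>2 \<Longrightarrow> pure_elem v w m n \<in> carrier TT"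
  by (meson tensor_elem_hom(2) monoid_hom_closed A.talented_elem_closed B.talented_elem_closed)

text \<open>By \<open>talented_lift\<close> only the edge relations need checking. For a direction
  in one block, tensoring with the fixed generator of the other factor is a homomorphism and carries
  over the relation of that block.\<close>

lemma ex_prod_to_tensor:
  "\<exists>f. monoid_hom TP TT f \<and>
    (\<forall>v \<in> obj \<Lambda>1. \<forall>w \<in> obj \<Lambda>2. \<forall>m n. f (prod_elem v w m n) = pure_elem v w m n)"
proof -
  \<comment> \<open>A degree of the product graph is split into its blocks, which shift the two
    tensor factors separately.\<close>
  define g where "g = (\<lambda>(v, w) q. pure_elem v w (fst_vec q) (snd_vec q))"
  have gc: "g (v, w) q \<in> carrier TT" if "v \<in> obj \<Lambda>1" "w \<in> obj \<Lambda>2" for v w q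
    using that by (simp add: g_def pure_elem_closed)
  have rel: "g (v, w) q = finprod TT (\<lambda>\<alpha>. g (src (prod_graph \<Lambda>1 \<Lambda>2) \<alpha>) (q + axis c 1))
      (paths (prod_graph \<Lambda>1 \<Lambda>2) (v, w) (axis c 1))"
    if v: "v \<in> obj \<Lambda>1" and w: "w \<in> obj \<Lambda>2" for v w q c
  proof (cases c)
    case (Inl i)
    have "g (v, w) q = tensor_elem T1 T2 (finprod T1
        (\<lambda>\<alpha>. talented_elem \<Lambda>1 (src \<Lambda>1 \<alpha>) (fst_vec q + axis i 1)) (paths \<Lambda>1 v (axis i 1)))
        (talented_elem \<Lambda>2 w (snd_vec q))"
      using A.talented_elem_relation[OF v, of "fst_vec q" i] by (simp add: g_def)
    also have "\<dots> = finprod TT (\<lambda>\<alpha>. pure_elem (src \<Lambda>1 \<alpha>) w (fst_vec q + axis i 1) (snd_vec q))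
        (paths \<Lambda>1 v (axis i 1))"
      by (rule monoid_hom_finprod[OF comm_monoids(1,4)
            tensor_elem_hom(1)[OF B.talented_elem_closed[OF w]]])
        (auto simp: A.finite_paths v A.talented_elem_closed A.src_paths)
    also have "\<dots> = finprod TT (\<lambda>\<alpha>. g (src \<Lambda>1 \<alpha>, w) (q + axis c 1)) (paths \<Lambda>1 v (axis i 1))"
      by (simp add: g_def Inl fst_vec_add snd_vec_add)
    finally show ?thesis
      using finprod_paths_prod(1)[where g = "\<lambda>u. g u (q + axis c 1)", OF comm_monoids(4) v w gc, of i]
      by (simp add: Inl)
  next
    case (Inr j)
    have "g (v, w) q = tensor_elem T1 T2 (talented_elem \<Lambda>1 v (fst_vec q)) (finprod T2
        (\<lambda>\<beta>. talented_elem \<Lambda>2 (src \<Lambda>2 \<beta>) (snd_vec q + axis j 1)) (paths \<Lambda>2 w (axis j 1)))"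
      using B.talented_elem_relation[OF w, of "snd_vec q" j] by (simp add: g_def)
    also have "\<dots> = finprod TT (\<lambda>\<beta>. pure_elem v (src \<Lambda>2 \<beta>) (fst_vec q) (snd_vec q + axis j 1))
        (paths \<Lambda>2 w (axis j 1))"
      by (rule monoid_hom_finprod[OF comm_monoids(2,4)
            tensor_elem_hom(2)[OF A.talented_elem_closed[OF v]]])
        (auto simp: B.finite_paths w B.talented_elem_closed B.src_paths)
    also have "\<dots> = finprod TT (\<lambda>\<beta>. g (v, src \<Lambda>2 \<beta>) (q + axis c 1)) (paths \<Lambda>2 w (axis j 1))"
      by (simp add: g_def Inr fst_vec_add snd_vec_add)
    finally show ?thesis
      using finprod_paths_prod(2)[where g = "\<lambda>u. g u (q + axis c 1)", OF comm_monoids(4) v w gc, of j]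
      by (simp add: Inr)
  qed
  have "\<exists>f. monoid_hom TP TT f \<and>
      (\<forall>u \<in> obj (prod_graph \<Lambda>1 \<Lambda>2). \<forall>q. f (talented_elem (prod_graph \<Lambda>1 \<Lambda>2) u q) = g u q)"
    by (rule AB.talented_lift[OF comm_monoids(4)]) (use gc rel in \<open>auto simp: obj_prod\<close>)
  then show ?thesis
    by (auto simp: obj_prod g_def fst_vec_join snd_vec_join)
qed

text \<open>Edges in a direction of one block leave the vertex and degree of the other factor
  unchanged. The relations of the product graph thus become those of one factor with the other
  generator held fixed.\<close>

lemma prod_elem_relation:
  assumes v: "v \<in> obj \<Lambda>1" and w: "w \<in> obj \<Lambda>2"
  shows "prod_elem v w m n
      = finprod TP (\<lambda>\<alpha>. prod_elem (src \<Lambda>1 \<alpha>) w (m + axis i 1) n) (paths \<Lambda>1 v (axis i 1))"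
    and "prod_elem v w m n
      = finprod TP (\<lambda>\<beta>. prod_elem v (src \<Lambda>2 \<beta>) m (n + axis j 1)) (paths \<Lambda>2 w (axis j 1))"
proof -
  have vw: "(v, w) \<in> obj (prod_graph \<Lambda>1 \<Lambda>2)" using v w by (simp add: obj_prod)
  have c: "talented_elem (prod_graph \<Lambda>1 \<Lambda>2) (v', w') q \<in> carrier TP"
    if "v' \<in> obj \<Lambda>1" "w' \<in> obj \<Lambda>2" for v' w' q
    using that by (simp add: AB.talented_elem_closed obj_prod)
  show "prod_elem v w m n
      = finprod TP (\<lambda>\<alpha>. prod_elem (src \<Lambda>1 \<alpha>) w (m + axis i 1) n) (paths \<Lambda>1 v (axis i 1))"
    using AB.talented_elem_relation[OF vw, of "join_vec m n" "Inl i"]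
      finprod_paths_prod(1)[OF comm_monoids(3) v w,
        of "\<lambda>u. talented_elem (prod_graph \<Lambda>1 \<Lambda>2) u (join_vec m n + axis (Inl i) 1)", OF c, of i]
    by (simp add: join_vec_axis)
  show "prod_elem v w m n
      = finprod TP (\<lambda>\<beta>. prod_elem v (src \<Lambda>2 \<beta>) m (n + axis j 1)) (paths \<Lambda>2 w (axis j 1))"
    using AB.talented_elem_relation[OF vw, of "join_vec m n" "Inr j"]
      finprod_paths_prod(2)[OF comm_monoids(3) v w,
        of "\<lambda>u. talented_elem (prod_graph \<Lambda>1 \<Lambda>2) u (join_vec m n + axis (Inr j) 1)", OF c, of j]
    by (simp add: join_vec_axis)
qed

text \<open>Two applications of \<open>talented_lift\<close>: \<open>h w n\<close> extends the map
  to \<open>T1\<close> for a fixed generator of \<open>T2\<close>, and then \<open>k x\<close>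
  extends it to \<open>T2\<close> for a fixed element of \<open>T1\<close>.\<close>

lemma ex_bilinear_to_prod:
  "\<exists>\<beta>. bilinear_map T1 T2 TP \<beta> \<and>
    (\<forall>v \<in> obj \<Lambda>1. \<forall>w \<in> obj \<Lambda>2. \<forall>m n.
      \<beta> (talented_elem \<Lambda>1 v m) (talented_elem \<Lambda>2 w n) = prod_elem v w m n)"
proof -
  interpret TP: comm_monoid TP by (rule comm_monoids)
  interpret T1: comm_monoid T1 by (rule comm_monoids)
  have "\<exists>h. monoid_hom T1 TP h \<and>
      (\<forall>v \<in> obj \<Lambda>1. \<forall>m. h (talented_elem \<Lambda>1 v m) = prod_elem v w m n)"
    if w: "w \<in> obj \<Lambda>2" for w n
    by (rule A.talented_lift[OF comm_monoids(3)])
      (use w in \<open>simp_all only: prod_elem_closed prod_elem_relation(1)[symmetric]\<close>)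
  then obtain h where h: "\<And>w n. w \<in> obj \<Lambda>2 \<Longrightarrow> monoid_hom T1 TP (h w n)"
    and hv: "\<And>v w m n. v \<in> obj \<Lambda>1 \<Longrightarrow> w \<in> obj \<Lambda>2
      \<Longrightarrow> h w n (talented_elem \<Lambda>1 v m) = prod_elem v w m n"
    by metis
  \<comment> \<open>The second extension needs the edge relations of \<Lambda>2 at every
    \<open>x\<close>. Both sides are homomorphisms in \<open>x\<close>, so the case of a generator
    \<open>v(m)\<close> suffices, and there it is \<open>prod_elem_relation(2)\<close>.\<close>
  have hrel: "h w n x = finprod TP (\<lambda>\<beta>. h (src \<Lambda>2 \<beta>) (n + axis j 1) x) (paths \<Lambda>2 w (axis j 1))"
    if w: "w \<in> obj \<Lambda>2" and x: "x \<in> carrier T1" for w n x j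
  proof (rule A.talented_hom_unique[OF comm_monoids(3) h[OF w] _ _ x])
    show "monoid_hom T1 TP
        (\<lambda>x. finprod TP (\<lambda>\<beta>. h (src \<Lambda>2 \<beta>) (n + axis j 1) x) (paths \<Lambda>2 w (axis j 1)))"
      by (rule finprod_monoid_hom[OF comm_monoids(1,3)]) (simp add: h B.src_paths)
    show "h w n (talented_elem \<Lambda>1 v m) = finprod TP
        (\<lambda>\<beta>. h (src \<Lambda>2 \<beta>) (n + axis j 1) (talented_elem \<Lambda>1 v m)) (paths \<Lambda>2 w (axis j 1))"
      if v: "v \<in> obj \<Lambda>1" for v m
      unfolding hv[OF v w] prod_elem_relation(2)[OF v w, of m n j]
      by (rule TP.finprod_cong') (auto simp: hv v B.src_paths prod_elem_closed)
  qed
  have "\<exists>k. monoid_hom T2 TP k \<and>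
      (\<forall>w \<in> obj \<Lambda>2. \<forall>n. k (talented_elem \<Lambda>2 w n) = h w n x)" if x: "x \<in> carrier T1" for x
    by (rule B.talented_lift[OF comm_monoids(3)])
      (use x in \<open>simp_all only: hrel[symmetric] monoid_hom_closed[OF h]\<close>)
  then obtain k where k: "\<And>x. x \<in> carrier T1 \<Longrightarrow> monoid_hom T2 TP (k x)"
    and kw: "\<And>x w n. x \<in> carrier T1 \<Longrightarrow> w \<in> obj \<Lambda>2 \<Longrightarrow> k x (talented_elem \<Lambda>2 w n) = h w n x"
    by metis
  note kc = monoid_hom_closed[OF k]
  \<comment> \<open>Linearity in the second variable is built into \<open>k\<close>. For the first,
    both sides of each law are homomorphisms in \<open>y\<close>, and at a generator
    \<open>w(n)\<close> they reduce to the homomorphism \<open>h w n\<close>.\<close>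
  have "monoid_hom T1 TP (\<lambda>x. k x y)" if y: "y \<in> carrier T2" for y
  proof (rule monoid_homI)
    fix x x' assume x: "x \<in> carrier T1" "x' \<in> carrier T1"
    show "k (x \<otimes>\<^bsub>T1\<^esub> x') y = k x y \<otimes>\<^bsub>TP\<^esub> k x' y"
    proof (rule B.talented_hom_unique[OF comm_monoids(3) k _ _ y])
      show "monoid_hom T2 TP (\<lambda>y. k x y \<otimes>\<^bsub>TP\<^esub> k x' y)"
        by (rule monoid_homI)
          (use x in \<open>auto simp: kc monoid_hom_mult[OF k] monoid_hom_one[OF k] TP.m_ac\<close>)
    qed (use x in \<open>auto simp: kw monoid_hom_mult[OF h]\<close>)
  next
    show "k \<one>\<^bsub>T1\<^esub> y = \<one>\<^bsub>TP\<^esub>"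
      by (rule B.talented_hom_unique[OF comm_monoids(3) k _ _ y])
        (auto simp: kw monoid_hom_one[OF h] intro!: monoid_homI)
  qed (simp add: kc y)
  then have "bilinear_map T1 T2 TP k" by (simp add: bilinear_map_def k)
  then show ?thesis using kw hv by (auto simp: A.talented_elem_closed)
qed

section \<open>The isomorphism and the transported action\<close>

lemma pure_elem_hom_unique:
  assumes P: "comm_monoid P" and f: "monoid_hom TT P f" and f': "monoid_hom TT P f'"
    and eq: "\<And>v w m n. v \<in> obj \<Lambda>1 \<Longrightarrow> w \<in> obj \<Lambda>2
      \<Longrightarrow> f (pure_elem v w m n) = f' (pure_elem v w m n)"
    and t: "t \<in> carrier TT"
  shows "f t = f' t"
proof (rule tensor_hom_unique[OF comm_monoids(1,2) P f f' _ t])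
  fix x y assume x: "x \<in> carrier T1" and y: "y \<in> carrier T2"
  \<comment> \<open>Fixing one tensor argument leaves a homomorphism in the other. First
    \<open>x\<close> is reduced to a generator with \<open>y\<close> fixed, then \<open>y\<close> is
    reduced with that generator fixed.\<close>
  note hom1 = monoid_hom_compose[OF tensor_elem_hom(1)]
    and hom2 = monoid_hom_compose[OF tensor_elem_hom(2)]
  show "f (tensor_elem T1 T2 x y) = f' (tensor_elem T1 T2 x y)"
  proof (rule A.talented_hom_unique[OF P hom1[OF y f] hom1[OF y f'] _ x])
    fix v m assume v: "v \<in> obj \<Lambda>1"
    note v' = A.talented_elem_closed[OF v]
    show "f (tensor_elem T1 T2 (talented_elem \<Lambda>1 v m) y)
        = f' (tensor_elem T1 T2 (talented_elem \<Lambda>1 v m) y)"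
      by (rule B.talented_hom_unique[OF P hom2[OF v' f] hom2[OF v' f'] _ y]) (rule eq[OF v])
  qed
qed

text \<open>Both composites are homomorphisms that fix the generators, hence are identities on the
  carriers.\<close>

lemma ex_iso_prod_tensor:
  "\<exists>f \<in> iso TP TT. \<forall>v \<in> obj \<Lambda>1. \<forall>w \<in> obj \<Lambda>2. \<forall>m n. f (prod_elem v w m n) = pure_elem v w m n"
proof -
  obtain f where f: "monoid_hom TP TT f"
    and fe: "\<And>v w m n. v \<in> obj \<Lambda>1 \<Longrightarrow> w \<in> obj \<Lambda>2 \<Longrightarrow> f (prod_elem v w m n) = pure_elem v w m n"
    using ex_prod_to_tensor by blast
  obtain \<beta> where \<beta>: "bilinear_map T1 T2 TP \<beta>"
    and \<beta>e: "\<And>v w m n. v \<in> obj \<Lambda>1 \<Longrightarrow> w \<in> obj \<Lambda>2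
      \<Longrightarrow> \<beta> (talented_elem \<Lambda>1 v m) (talented_elem \<Lambda>2 w n) = prod_elem v w m n"
    using ex_bilinear_to_prod by blast
  obtain g where g: "monoid_hom TT TP g"
    and ge: "\<forall>x \<in> carrier T1. \<forall>y \<in> carrier T2. g (tensor_elem T1 T2 x y) = \<beta> x y"
    using tensor_universal[OF comm_monoids(1-3) \<beta>] by (elim exE conjE) (rule that)
  have ge': "g (pure_elem v w m n) = prod_elem v w m n" if "v \<in> obj \<Lambda>1" "w \<in> obj \<Lambda>2" for v w m n
    using that by (simp add: ge \<beta>e A.talented_elem_closed B.talented_elem_closed)
  have "f \<in> iso TP TT"
  proof (rule iso_if_inverse_homs[OF f g])
    fix x assume x: "x \<in> carrier TP"
    show "g (f x) = x"
    proof (rule AB.talented_hom_unique[OF comm_monoids(3) monoid_hom_compose[OF f g] monoid_hom_id _ x])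
      fix u :: "'o1 \<times> 'o2" and q :: "int ^ ('k + 'l)" assume "u \<in> obj (prod_graph \<Lambda>1 \<Lambda>2)"
      then obtain v w where "u = (v, w)" "v \<in> obj \<Lambda>1" "w \<in> obj \<Lambda>2" by (auto simp: obj_prod)
      \<comment> \<open>Every degree is the join of its blocks, so every generator of
        \<open>TP\<close> is a \<open>prod_elem\<close>.\<close>
      moreover have "q = join_vec (fst_vec q) (snd_vec q)" by (metis join_vec_eq_iff)
      ultimately show "g (f (talented_elem (prod_graph \<Lambda>1 \<Lambda>2) u q))
          = talented_elem (prod_graph \<Lambda>1 \<Lambda>2) u q"
        by (metis fe ge')
    qed
  next
    show "f (g t) = t" if "t \<in> carrier TT" for t
      by (rule pure_elem_hom_unique[OF comm_monoids(4) monoid_hom_compose[OF g f] monoid_hom_id _ that])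
        (simp add: fe ge')
  qed
  with fe show ?thesis by blast
qed

end

theorem proposition3p1p1:
  fixes \<Lambda>1 :: "('o1, 'm1, 'k::finite) graph_data"
    and \<Lambda>2 :: "('o2, 'm2, 'l::finite) graph_data"
  assumes "higher_rank_graph \<Lambda>1" and "row_finite_no_sources \<Lambda>1"
    and "higher_rank_graph \<Lambda>2" and "row_finite_no_sources \<Lambda>2"
  shows "\<exists>\<psi> :: int ^ ('k + 'l) \<Rightarrow> _.
    gamma_monoid int_vec_group (tensor_monoid (talented_monoid \<Lambda>1) (talented_monoid \<Lambda>2)) \<psi> \<and>
    (\<forall>v \<in> obj \<Lambda>1. \<forall>w \<in> obj \<Lambda>2. \<forall>m n q.
      \<psi> q (tensor_elem (talented_monoid \<Lambda>1) (talented_monoid \<Lambda>2)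
            (talented_elem \<Lambda>1 v m) (talented_elem \<Lambda>2 w n))
        = tensor_elem (talented_monoid \<Lambda>1) (talented_monoid \<Lambda>2)
            (talented_elem \<Lambda>1 v (m + fst_vec q)) (talented_elem \<Lambda>2 w (n + snd_vec q))) \<and>
    gamma_isomorphic int_vec_group
      (talented_monoid (prod_graph \<Lambda>1 \<Lambda>2)) (talented_action (prod_graph \<Lambda>1 \<Lambda>2))
      (tensor_monoid (talented_monoid \<Lambda>1) (talented_monoid \<Lambda>2)) \<psi>"
proof -
  interpret row_finite_graph_pair \<Lambda>1 \<Lambda>2
    using assms
    by (simp add: row_finite_graph_pair_def row_finite_graph_def row_finite_graph_axioms_def)
  let ?act = "talented_action (prod_graph \<Lambda>1 \<Lambda>2)"
  obtain f where f: "f \<in> iso TP TT"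
    and fe: "\<And>v w m n. v \<in> obj \<Lambda>1 \<Longrightarrow> w \<in> obj \<Lambda>2 \<Longrightarrow> f (prod_elem v w m n) = pure_elem v w m n"
    using ex_iso_prod_tensor by blast
  \<comment> \<open>The shift on \<open>TP\<close> is conjugated by \<open>f\<close>; the
    restriction to the carrier supplies the extensionality required by
    \<open>group_action\<close>.\<close>
  define \<psi> where "\<psi> = (\<lambda>q. \<lambda>t \<in> carrier TT. f (?act q (inv_into (carrier TP) f t)))"
  have iso: "gamma_isomorphic int_vec_group TP ?act TT \<psi>"
    unfolding \<psi>_def
    by (rule gamma_isomorphic_transport[OF AB.gamma_monoid_talented comm_monoids(4) f])
  \<comment> \<open>A pure tensor of generators is pulled back to a generator of \<open>TP\<close>,
    shifted there blockwise and sent forward by \<open>f\<close> again.\<close>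
  have "\<psi> q (pure_elem v w m n) = pure_elem v w (m + fst_vec q) (n + snd_vec q)"
    if v: "v \<in> obj \<Lambda>1" and w: "w \<in> obj \<Lambda>2" for v w m n q
  proof -
    have "inv_into (carrier TP) f (pure_elem v w m n) = prod_elem v w m n"
      using f v w inv_into_f_f[of f "carrier TP" "prod_elem v w m n"]
      by (simp add: fe prod_elem_closed iso_def bij_betw_def)
    then have "\<psi> q (pure_elem v w m n) = f (?act q (prod_elem v w m n))"
      using v w by (simp add: \<psi>_def pure_elem_closed)
    also have "?act q (prod_elem v w m n) = prod_elem v w (m + fst_vec q) (n + snd_vec q)"
    proof -
      have "join_vec (m + fst_vec q) (n + snd_vec q) = join_vec m n + q"
        by (simp add: join_vec_eq_iff fst_vec_add snd_vec_add fst_vec_join snd_vec_join)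
      then show ?thesis using v w by (simp add: AB.talented_action_elem obj_prod)
    qed
    finally show ?thesis using v w by (simp add: fe)
  qed
  moreover have "gamma_monoid int_vec_group TT \<psi>"
    using iso by (simp add: gamma_isomorphic_def)
  ultimately show ?thesis using iso by blast
qed

end
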